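(* Let $d$ and $k$ be positive integers with $d$ odd, and put $$n(d,k)=k+\binom{d+k-1}{d}.$$ Then for every $n\ge n(d,k)$ every (continuous) section of the bundle $\Sigma^d(\gamma_n^k)$ over $G_n^k$ has a zero.
   Context: $G_n^k$ is the Grassmannian of $k$-dimensional linear subspaces of $\mathbb R^n$, and $\gamma_n^k:E(\gamma_n^k)\to G_n^k$ is its canonical (tautological) real vector bundle, whose fiber over $V$ is $V$. For a vector bundle $\xi$, $\Sigma^d(\xi)$ denotes its fiberwise symmetric $d$-th power; using a Riemannian metric on the fibers of $\xi$, the fiber of $\Sigma^d(\xi)$ over a point may be regarded as the space of homogeneous polynomials of degree $d$ on the fiber of $\xi$ over that point. All sections are continuous. *)

theory Defs
  imports "HOL-Analysis.Analysis"
begin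

definition k_subspaces :: "nat \<Rightarrow> ((real^'n) set) set"
  where "k_subspaces k = {V. subspace V \<and> dim V = k}"

definition frames :: "nat \<Rightarrow> (nat \<Rightarrow> real^'n) topology"
  where "frames k = subtopology (product_topology (\<lambda>_. euclidean) {..<k})
    {f. inj_on f {..<k} \<and> independent (f ` {..<k})}"

text \<open>The Grassmannian carries the quotient topology under \<open>f \<mapsto> span (f ` {..<k})\<close>; see
  \<open>quotient_map_span\<close> below.\<close>

definition grassmannian :: "nat \<Rightarrow> ((real^'n) set) topology"
  where "grassmannian k = topology (\<lambda>U. U \<subseteq> k_subspaces k \<and>
    openin (frames k) {f \<in> topspace (frames k). span (f ` {..<k}) \<in> U})"

text \<open>The inner product identifies a product \<open>a\<^sub>1 \<cdots> a\<^sub>d\<close> of vectors with the homogeneous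
  polynomial \<open>x \<mapsto> (a\<^sub>1 \<bullet> x) \<cdots> (a\<^sub>d \<bullet> x)\<close> on the whole space. The symmetric power of \<open>V\<close> is
  the subspace of the symmetric power of the whole space spanned by the products of
  vectors of \<open>V\<close>. Restriction to \<open>V\<close> identifies it with the homogeneous polynomials on \<open>V\<close>
  (\<open>bij_betw_symmetric_power\<close> below).\<close>

definition symmetric_power :: "nat \<Rightarrow> (real^'n) set \<Rightarrow> (real^'n \<Rightarrow> real) set"
  where "symmetric_power d V = {p. \<exists>N c a. (\<forall>j<N. \<forall>i<d. a j i \<in> V) \<and>
    p = (\<lambda>x. \<Sum>j<(N::nat). c j * (\<Prod>i<d. a j i \<bullet> x))}"

text \<open>The tautological bundle is a subbundle of the trivial bundle, so its symmetric power is
  a subbundle of the trivial bundle whose fiber is the symmetric power of the whole space.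
  On that finite-dimensional space of functions, pointwise convergence is the
  vector space topology.\<close>

definition symmetric_power_bundle :: "nat \<Rightarrow> nat \<Rightarrow> ((real^'n) set \<times> (real^'n \<Rightarrow> real)) topology"
  where "symmetric_power_bundle d k =
    subtopology (prod_topology (grassmannian k) (powertop_real UNIV))
      (SIGMA V : k_subspaces k. symmetric_power d V)"

definition bundle_section ::
    "nat \<Rightarrow> nat \<Rightarrow> ((real^'n) set \<Rightarrow> (real^'n) set \<times> (real^'n \<Rightarrow> real)) \<Rightarrow> bool"
  where "bundle_section d k s \<longleftrightarrow>
    continuous_map (grassmannian k) (symmetric_power_bundle d k) s \<and>
    (\<forall>V \<in> k_subspaces k. fst (s V) = V)"

definition has_zero :: "nat \<Rightarrow> ((real^'n) set \<Rightarrow> (real^'n) set \<times> (real^'n \<Rightarrow> real)) \<Rightarrow> bool"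
  where "has_zero k s \<longleftrightarrow> (\<exists>V \<in> k_subspaces k. s V = (V, \<lambda>x. 0))"


subsection \<open>The topology of the Grassmannian\<close>

lemma openin_grassmannian:
  "openin (grassmannian k) U \<longleftrightarrow> U \<subseteq> k_subspaces k \<and>
    openin (frames k) {f \<in> topspace (frames k). span (f ` {..<k}) \<in> U}"
proof -
  have "istopology (\<lambda>U. U \<subseteq> k_subspaces k \<and>
      openin (frames k) {f \<in> topspace (frames k). span (f ` {..<k}) \<in> U})" (is "istopology ?P")
    unfolding istopology_def
  proof (intro conjI allI impI)
    fix S T assume *: "?P S" "?P T"
    then show "S \<inter> T \<subseteq> k_subspaces k" by auto
    have "{f \<in> topspace (frames k). span (f ` {..<k}) \<in> S \<inter> T} =
      {f \<in> topspace (frames k). span (f ` {..<k}) \<in> S} \<inter>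
      {f \<in> topspace (frames k). span (f ` {..<k}) \<in> T}" by auto
    with * show "openin (frames k) {f \<in> topspace (frames k). span (f ` {..<k}) \<in> S \<inter> T}"
      by (metis (no_types, lifting) openin_Int)
  next
    fix K assume *: "\<forall>S\<in>K. ?P S"
    then show "\<Union> K \<subseteq> k_subspaces k" by auto
    have "{f \<in> topspace (frames k). span (f ` {..<k}) \<in> \<Union> K} =
      (\<Union>S\<in>K. {f \<in> topspace (frames k). span (f ` {..<k}) \<in> S})" by auto
    moreover have "openin (frames k) (\<Union>S\<in>K. {f \<in> topspace (frames k). span (f ` {..<k}) \<in> S})"
      using * by (intro openin_Union) auto
    ultimately show "openin (frames k) {f \<in> topspace (frames k). span (f ` {..<k}) \<in> \<Union> K}"
      by simp
  qed
  then show ?thesis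
    unfolding grassmannian_def by (subst topology_inverse') auto
qed

lemma topspace_frames:
  "f \<in> topspace (frames k) \<longleftrightarrow>
    f \<in> extensional {..<k} \<and> inj_on f {..<k} \<and> independent (f ` {..<k})"
  by (auto simp: frames_def PiE_def)

lemma span_frame:
  assumes "f \<in> topspace (frames k)"
  shows "span (f ` {..<k}) \<in> k_subspaces k"
  using assms by (simp add: topspace_frames k_subspaces_def dim_eq_card_independent card_image)

lemma topspace_grassmannian [simp]: "topspace (grassmannian k) = k_subspaces k"
proof -
  have eq: "{f \<in> topspace (frames k). span (f ` {..<k}) \<in> k_subspaces k} = topspace (frames k)"
    using span_frame by blast
  have "openin (grassmannian k) (k_subspaces k)"
    unfolding openin_grassmannian eq by simp
  then show ?thesis
    by (meson openin_grassmannian openin_subset openin_topspace subset_antisym)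
qed

lemma ex_frame:
  fixes V :: "(real^'n) set"
  assumes "V \<in> k_subspaces k"
  obtains f where "f \<in> topspace (frames k)" "span (f ` {..<k}) = V"
proof -
  have V: "subspace V" "dim V = k" using assms by (auto simp: k_subspaces_def)
  obtain B where B: "B \<subseteq> V" "independent B" "V \<subseteq> span B" "card B = dim V"
    using basis_exists by blast
  then obtain g where g: "bij_betw g {..<k} B"
    using V(2) finiteI_independent[OF B(2)] ex_bij_betw_nat_finite[of B]
    by (auto simp: atLeast0LessThan)
  let ?f = "restrict g {..<k}"
  have im: "?f ` {..<k} = B" using g by (auto simp: bij_betw_def)
  have "inj_on ?f {..<k}" using g by (auto simp: bij_betw_def inj_on_def)
  then have "?f \<in> topspace (frames k)" unfolding topspace_frames im using B(2) by simp
  moreover have "span B = V" using B V by (meson span_minimal subset_antisym)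
  ultimately show thesis using that im by metis
qed

lemma quotient_map_span:
  "quotient_map (frames k) (grassmannian k) (\<lambda>f. span (f ` {..<k}))"
proof -
  have "(\<lambda>f. span (f ` {..<k})) ` topspace (frames k) = k_subspaces k"
    using span_frame ex_frame by (metis (no_types, lifting) image_eqI image_subsetI subsetI subset_antisym)
  then show ?thesis
    unfolding quotient_map_def by (simp add: openin_grassmannian)
qed


subsection \<open>Symmetric powers and homogeneous polynomials\<close>

lemma symmetric_powerI:
  "(\<And>j i. j < N \<Longrightarrow> i < d \<Longrightarrow> a j i \<in> V) \<Longrightarrow>
    (\<lambda>x. \<Sum>j<(N::nat). c j * (\<Prod>i<d. a j i \<bullet> x)) \<in> symmetric_power d V"
  unfolding symmetric_power_def by (intro CollectI exI[of _ N] exI[of _ c] exI[of _ a]) simp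

lemma symmetric_powerE:
  assumes "p \<in> symmetric_power d V"
  obtains N c a where "\<forall>j<N. \<forall>i<d. a j i \<in> V"
    "p = (\<lambda>x. \<Sum>j<(N::nat). c j * (\<Prod>i<d. a j i \<bullet> x))"
  using assms unfolding symmetric_power_def by auto

lemma symmetric_power_0: "(\<lambda>x. 0) \<in> symmetric_power d V"
  using symmetric_powerI[of 0 d "\<lambda>_ _. 0"] by simp

lemma symmetric_power_monomial:
  "(\<And>i. i < d \<Longrightarrow> a i \<in> V) \<Longrightarrow> (\<lambda>x. c * (\<Prod>i<d. a i \<bullet> x)) \<in> symmetric_power d V"
  using symmetric_powerI[of 1 d "\<lambda>_. a" V "\<lambda>_. c"] by simp

lemma symmetric_power_add:
  assumes "p \<in> symmetric_power d V" "q \<in> symmetric_power d V"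
  shows "(\<lambda>x. p x + q x) \<in> symmetric_power d V"
proof -
  obtain N c a where p: "\<forall>j<N. \<forall>i<d. a j i \<in> V"
    "p = (\<lambda>x. \<Sum>j<(N::nat). c j * (\<Prod>i<d. a j i \<bullet> x))"
    by (rule symmetric_powerE[OF assms(1)])
  obtain M e b where q: "\<forall>j<M. \<forall>i<d. b j i \<in> V"
    "q = (\<lambda>x. \<Sum>j<(M::nat). e j * (\<Prod>i<d. b j i \<bullet> x))"
    by (rule symmetric_powerE[OF assms(2)])
  let ?c = "\<lambda>j. if j < N then c j else e (j - N)"
  let ?a = "\<lambda>j. if j < N then a j else b (j - N)"
  have "(\<lambda>x. \<Sum>j<N+M. ?c j * (\<Prod>i<d. ?a j i \<bullet> x)) \<in> symmetric_power d V"
    by (rule symmetric_powerI) (auto simp: p q)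
  also have "(\<lambda>x. \<Sum>j<N+M. ?c j * (\<Prod>i<d. ?a j i \<bullet> x)) = (\<lambda>x. p x + q x)"
  proof
    fix x
    let ?g = "\<lambda>j. ?c j * (\<Prod>i<d. ?a j i \<bullet> x)"
    have "(\<Sum>j<N+M. ?g j) = (\<Sum>j<N. ?g j) + (\<Sum>j<M. ?g (N + j))"
      by (induction M) (simp_all add: algebra_simps)
    also have "\<dots> = p x + q x" unfolding p(2) q(2) by simp
    finally show "(\<Sum>j<N+M. ?g j) = p x + q x" .
  qed
  finally show ?thesis .
qed

lemma symmetric_power_sum:
  "(\<And>j. j \<in> A \<Longrightarrow> p j \<in> symmetric_power d V) \<Longrightarrow> (\<lambda>x. \<Sum>j\<in>A. p j x) \<in> symmetric_power d V"
proof (induction A rule: infinite_finite_induct)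
  case (insert j A)
  then show ?case using symmetric_power_add[of "p j" d V "\<lambda>x. \<Sum>j\<in>A. p j x"] by simp
qed (simp_all add: symmetric_power_0)

lemma symmetric_power_mult:
  assumes "p \<in> symmetric_power d V" "q \<in> symmetric_power e V"
  shows "(\<lambda>x. p x * q x) \<in> symmetric_power (d + e) V"
proof -
  obtain N c a where p: "\<forall>j<N. \<forall>i<d. a j i \<in> V"
    "p = (\<lambda>x. \<Sum>j<(N::nat). c j * (\<Prod>i<d. a j i \<bullet> x))"
    by (rule symmetric_powerE[OF assms(1)])
  obtain M c' b where q: "\<forall>j<M. \<forall>i<e. b j i \<in> V"
    "q = (\<lambda>x. \<Sum>j<(M::nat). c' j * (\<Prod>i<e. b j i \<bullet> x))"
    by (rule symmetric_powerE[OF assms(2)])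
  let ?w = "\<lambda>j l i. if i < d then a j i else b l (i - d)"
  have split: "(\<Prod>i<d+e. ?w j l i \<bullet> x) = (\<Prod>i<d. a j i \<bullet> x) * (\<Prod>i<e. b l i \<bullet> x)" for j l x
  proof -
    have "(\<Prod>i<d+e. ?w j l i \<bullet> x) = (\<Prod>i<d. ?w j l i \<bullet> x) * (\<Prod>i<e. ?w j l (d + i) \<bullet> x)"
      by (induction e) (simp_all add: algebra_simps)
    then show ?thesis by simp
  qed
  have "(\<lambda>x. \<Sum>j<N. \<Sum>l<M. (c j * c' l) * (\<Prod>i<d+e. ?w j l i \<bullet> x)) \<in> symmetric_power (d+e) V"
    by (intro symmetric_power_sum symmetric_power_monomial) (auto simp: p q)
  also have "(\<lambda>x. \<Sum>j<N. \<Sum>l<M. (c j * c' l) * (\<Prod>i<d+e. ?w j l i \<bullet> x)) = (\<lambda>x. p x * q x)"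
    unfolding p(2) q(2) split sum_product by (simp add: mult_ac)
  finally show ?thesis .
qed

lemma symmetric_power_scale:
  assumes "p \<in> symmetric_power d V"
  shows "p (t *\<^sub>R x) = t ^ d * p x"
proof -
  obtain N c a where p: "p = (\<lambda>x. \<Sum>j<(N::nat). c j * (\<Prod>i<d. a j i \<bullet> x))"
    by (rule symmetric_powerE[OF assms])
  show ?thesis unfolding p by (simp add: prod.distrib sum_distrib_left algebra_simps)
qed

lemma symmetric_power_polynomial:
  assumes "p \<in> symmetric_power d V"
  shows "real_polynomial_function p"
proof -
  obtain N c a where p: "p = (\<lambda>x. \<Sum>j<(N::nat). c j * (\<Prod>i<d. a j i \<bullet> x))"
    by (rule symmetric_powerE[OF assms])
  show ?thesis unfolding p
    by (intro real_polynomial_function_sum real_polynomial_function_prod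
        real_polynomial_function.intros bounded_linear_inner_right) auto
qed

lemma real_polynomial_function_homogeneous_parts:
  fixes p :: "real^'n \<Rightarrow> real"
  assumes "real_polynomial_function p"
  obtains h D where "\<And>e. h e \<in> symmetric_power e UNIV" "\<And>e. e > D \<Longrightarrow> h e = (\<lambda>x. 0)"
    "p = (\<lambda>x. \<Sum>e\<le>D. h e x)"
proof -
  define H where "H = {p. \<exists>h D. (\<forall>e. h e \<in> symmetric_power e (UNIV :: (real^'n) set)) \<and>
    (\<forall>e>D. h e = (\<lambda>x. 0)) \<and> p = (\<lambda>x. \<Sum>e\<le>(D::nat). h e x)}"
  have H0: "q \<in> H" if "q \<in> symmetric_power e UNIV" for q e
  proof -
    have "q = (\<lambda>x. \<Sum>i\<le>e. (if i = e then q else (\<lambda>x. 0)) x)"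
      by (simp add: if_distribR)
    then show ?thesis unfolding H_def using that symmetric_power_0
      by (intro CollectI exI[of _ "\<lambda>i. if i = e then q else (\<lambda>x. 0)"] exI[of _ e]) auto
  qed
  have H_add: "(\<lambda>x. q x + r x) \<in> H" if qr: "q \<in> H" "r \<in> H" for q r
  proof -
    obtain h D where q: "\<forall>e. h e \<in> symmetric_power e UNIV" "\<forall>e>D. h e = (\<lambda>x. 0)"
      "q = (\<lambda>x. \<Sum>e\<le>(D::nat). h e x)" using qr(1) unfolding H_def by blast
    obtain h' D' where r: "\<forall>e. h' e \<in> symmetric_power e UNIV" "\<forall>e>D'. h' e = (\<lambda>x. 0)"
      "r = (\<lambda>x. \<Sum>e\<le>(D'::nat). h' e x)" using qr(2) unfolding H_def by blast
    have "q x = (\<Sum>e\<le>max D D'. h e x)" for x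
      unfolding q(3) by (rule sum.mono_neutral_left) (auto simp: q(2))
    moreover have "r x = (\<Sum>e\<le>max D D'. h' e x)" for x
      unfolding r(3) by (rule sum.mono_neutral_left) (auto simp: r(2))
    ultimately have "(\<lambda>x. q x + r x) = (\<lambda>x. \<Sum>e\<le>max D D'. h e x + h' e x)"
      by (simp add: sum.distrib)
    then show ?thesis unfolding H_def using q(1,2) r(1,2)
      by (intro CollectI exI[of _ "\<lambda>e x. h e x + h' e x"] exI[of _ "max D D'"])
        (auto intro!: symmetric_power_add)
  qed
  have H_sum: "(\<lambda>x. \<Sum>i\<in>A. q i x) \<in> H" if "\<And>i. i \<in> A \<Longrightarrow> q i \<in> H" for A :: "nat set" and q
    using that
  proof (induction A rule: infinite_finite_induct)
    case (insert j A)
    then show ?case using H_add[of "q j" "\<lambda>x. \<Sum>j\<in>A. q j x"] by simp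
  qed (simp_all add: H0[OF symmetric_power_0])
  have "p \<in> H"
    using assms
  proof (induction p rule: real_polynomial_function.induct)
    case (linear f)
    then have "f x = adjoint f 1 \<bullet> x" for x
      using adjoint_works[of f x 1] by (simp add: bounded_linear.linear inner_commute)
    then obtain w where "f = (\<lambda>x. w \<bullet> x)" by blast
    then show ?case using H0[OF symmetric_power_monomial[of 1 "\<lambda>_. w" UNIV 1]] by simp
  next
    case (const c)
    then show ?case using H0[OF symmetric_power_monomial[of 0 "\<lambda>_. 0" UNIV c]] by simp
  next
    case (add f g)
    then show ?case by (simp add: H_add)
  next
    case (mult q r)
    obtain h D where q: "\<forall>e. h e \<in> symmetric_power e UNIV"
      "q = (\<lambda>x. \<Sum>e\<le>(D::nat). h e x)" using mult.IH(1) unfolding H_def by blast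
    obtain h' D' where r: "\<forall>e. h' e \<in> symmetric_power e UNIV"
      "r = (\<lambda>x. \<Sum>e\<le>(D'::nat). h' e x)" using mult.IH(2) unfolding H_def by blast
    have "(\<lambda>x. \<Sum>e\<le>D. \<Sum>e'\<le>D'. h e x * h' e' x) \<in> H"
      by (intro H_sum H0[OF symmetric_power_mult]) (use q r in auto)
    then show ?case unfolding q(2) r(2) by (simp add: sum_product)
  qed
  then show thesis using that unfolding H_def by blast
qed

lemma orthogonal_projection_exists:
  fixes V :: "(real^'n) set"
  assumes "subspace V"
  obtains P where "\<And>x. P x \<in> V" "\<And>v x. v \<in> V \<Longrightarrow> v \<bullet> P x = v \<bullet> x"
proof -
  have "\<exists>y. y \<in> V \<and> (\<forall>v\<in>V. v \<bullet> y = v \<bullet> x)" for x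
  proof -
    obtain y z where "y \<in> span V" "\<And>w. w \<in> span V \<Longrightarrow> orthogonal z w" "x = y + z"
      using orthogonal_subspace_decomp_exists[of V x] by blast
    then show ?thesis using assms[folded span_eq_iff]
      by (auto simp: orthogonal_def inner_add_right inner_commute simp del: span_eq_iff intro!: exI[of _ y])
  qed
  then show thesis using that by metis
qed

text \<open>The polynomials on \<open>V\<close> are the restrictions of the polynomials on the whole space.\<close>

definition homogeneous_polynomials :: "nat \<Rightarrow> (real^'n) set \<Rightarrow> (real^'n \<Rightarrow> real) set"
  where "homogeneous_polynomials d V = {restrict q V | q.
    real_polynomial_function q \<and> (\<forall>t. \<forall>x\<in>V. q (t *\<^sub>R x) = t ^ d * q x)}"

lemma bij_betw_symmetric_power:
  fixes V :: "(real^'n) set"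
  assumes V: "subspace V"
  shows "bij_betw (\<lambda>p. restrict p V) (symmetric_power d V) (homogeneous_polynomials d V)"
proof -
  obtain P where P: "\<And>x. P x \<in> V" "\<And>v x. v \<in> V \<Longrightarrow> v \<bullet> P x = v \<bullet> x"
    using orthogonal_projection_exists[OF V] by blast
  have proj: "p (P x) = p x" if p_in: "p \<in> symmetric_power d V" for p x
  proof -
    obtain N c a where p: "\<forall>j<N. \<forall>i<d. a j i \<in> V"
      "p = (\<lambda>x. \<Sum>j<(N::nat). c j * (\<Prod>i<d. a j i \<bullet> x))"
      by (rule symmetric_powerE[OF p_in])
    show ?thesis unfolding p(2) by (auto intro!: sum.cong prod.cong simp: P(2) p(1))
  qed
  have "inj_on (\<lambda>p. restrict p V) (symmetric_power d V)"
  proof (rule inj_onI, rule ext)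
    fix p q x
    assume pq: "p \<in> symmetric_power d V" "q \<in> symmetric_power d V" "restrict p V = restrict q V"
    have "p (P x) = q (P x)" using fun_cong[OF pq(3), of "P x"] P(1) by simp
    then show "p x = q x" by (simp only: proj[OF pq(1)] proj[OF pq(2)])
  qed
  moreover have "restrict p V \<in> homogeneous_polynomials d V" if "p \<in> symmetric_power d V" for p
    using symmetric_power_polynomial[OF that] symmetric_power_scale[OF that]
    unfolding homogeneous_polynomials_def by blast
  moreover have "r \<in> (\<lambda>p. restrict p V) ` symmetric_power d V"
    if "r \<in> homogeneous_polynomials d V" for r
  proof -
    obtain q where q: "r = restrict q V" "real_polynomial_function q"
      "\<And>t x. x \<in> V \<Longrightarrow> q (t *\<^sub>R x) = t ^ d * q x"
      using \<open>r \<in> homogeneous_polynomials d V\<close> unfolding homogeneous_polynomials_def by blast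
    obtain h D where h: "\<And>e. h e \<in> symmetric_power e UNIV" "\<And>e. e > D \<Longrightarrow> h e = (\<lambda>x. 0)"
      "q = (\<lambda>x. \<Sum>e\<le>D. h e x)"
      using real_polynomial_function_homogeneous_parts[OF q(2)] by metis
    let ?D = "max D d"
    have qh: "q x = h d x" if "x \<in> V" for x
    proof -
      have "q y = (\<Sum>e\<le>?D. h e y)" for y
        unfolding h(3) by (rule sum.mono_neutral_left) (auto simp: h(2))
      then have 1: "(\<Sum>e\<le>?D. h e x * t ^ e) = t ^ d * q x" for t
        using q(3)[OF that, of t] by (simp add: symmetric_power_scale[OF h(1)] mult.commute)
      have 2: "(\<Sum>e\<le>?D. (if e = d then q x else 0) * t ^ e) = t ^ d * q x" for t
      proof -
        have "(\<Sum>e\<le>?D. (if e = d then q x else 0) * t ^ e) =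
          (\<Sum>e\<le>?D. if e = d then t ^ d * q x else 0)"
          by (rule sum.cong) auto
        then show ?thesis by simp
      qed
      have "\<forall>t. (\<Sum>e\<le>?D. h e x * t ^ e) = (\<Sum>e\<le>?D. (if e = d then q x else 0) * t ^ e)"
        unfolding 1 2 by simp
      then have "\<forall>e\<le>?D. h e x = (if e = d then q x else 0)"
        by (subst (asm) polyfun_eq_coeffs)
      then show ?thesis by simp
    qed
    obtain N c a where hd: "h d = (\<lambda>x. \<Sum>j<(N::nat). c j * (\<Prod>i<d. a j i \<bullet> x))"
      by (rule symmetric_powerE[OF h(1)])
    let ?p = "\<lambda>x. \<Sum>j<N. c j * (\<Prod>i<d. P (a j i) \<bullet> x)"
    have "?p \<in> symmetric_power d V" by (rule symmetric_powerI) (rule P(1))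
    moreover have "P v \<bullet> x = v \<bullet> x" if "x \<in> V" for v x
      using P(2)[OF that, of v] by (simp add: inner_commute)
    then have "r = restrict ?p V"
      unfolding q(1) by (auto simp: fun_eq_iff restrict_def qh hd)
    ultimately show ?thesis by blast
  qed
  ultimately show ?thesis unfolding bij_betw_def by blast
qed

end

theory Submission
  imports Defs "HOL-Library.Z2"
begin

text \<open>Let \<open>m\<close> be the number of monomials of degree \<open>d\<close> in \<open>k\<close> variables. As \<open>d\<close> is odd, each
  monomial has an odd exponent; put it into block \<open>i\<close> if its first odd exponent is the \<open>i\<close>-th
  one, and let \<open>b\<^sub>i\<close> be the size of block \<open>i\<close>. As \<open>n \<ge> m + k\<close>, there are \<open>k\<close> pairwise orthogonal
  spheres of dimensions \<open>b\<^sub>1, \<dots>, b\<^sub>k\<close> around the origin, and choosing a point on each gives a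
  \<open>k\<close>-frame. The coefficients of the section in this frame are \<open>m\<close> functions on the product of
  the spheres, each even or odd under every antipodal map.

  Such functions have a common zero. Each sphere is a cube with antipodal points of the boundary
  identified, and the cubes are triangulated finely. Modulo 2, the number of simplices whose
  \<open>t\<close>-th edge is a sign change of the \<open>t\<close>-th function, for all \<open>t\<close>, is a cup product evaluated on
  the fundamental cycle: it depends only on the parities. The blocks make the parities triangular,
  so that for a model sign pattern exactly one simplex is counted. Hence every triangulation has a
  simplex on which all functions change sign, and compactness gives a common zero.\<close>

subsection \<open>The triangulation of the cube\<close>

declare add_bit_eq_xor [simp del] mult_bit_eq_and [simp del]

lemma bit_add_self [simp]: "x + x = (0 :: bit)" "x + (x + y) = (y :: bit)"
  by (cases x; cases y; simp)+

lemma bit_add_eq_0_iff: "x + y = 0 \<longleftrightarrow> x = (y :: bit)"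
  by (cases x; cases y) simp_all

text \<open>The orbits of \<open>f\<close> are pairs on which \<open>c\<close> is constant, so each
  contributes \<open>c x + c x = 0\<close>; the induction removes one pair at a time.\<close>

lemma sum_bit_involution:
  fixes c :: "'a \<Rightarrow> bit"
  assumes "finite A" and f: "\<And>x. x \<in> A \<Longrightarrow> f x \<in> A" "\<And>x. x \<in> A \<Longrightarrow> f x \<noteq> x"
      "\<And>x. x \<in> A \<Longrightarrow> f (f x) = x" "\<And>x. x \<in> A \<Longrightarrow> c (f x) = c x"
  shows "sum c A = 0"
  using assms
proof (induction A rule: finite_psubset_induct)
  case (psubset A)
  show ?case
  proof (cases "A = {}")
    case False
    then obtain x where x: "x \<in> A" by blast
    let ?B = "A - {x, f x}"
    have "sum c ?B = 0"
    proof (rule psubset.IH)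
      fix y assume y: "y \<in> ?B"
      then have "f y \<noteq> x" "f y \<noteq> f x"
        using psubset.prems(3)[OF x] psubset.prems(3)[of y] x by auto
      then show "f y \<in> ?B" using psubset.prems(1) y by auto
    qed (use x psubset.prems in auto)
    moreover have "sum c A = c x + (c (f x) + sum c ?B)"
    proof -
      have "sum c A = c x + sum c (A - {x})"
        using psubset.hyps x by (rule sum.remove)
      also have "sum c (A - {x}) = c (f x) + sum c (A - {x} - {f x})"
        by (rule sum.remove) (use psubset x in auto)
      also have "A - {x} - {f x} = ?B" by blast
      finally show ?thesis .
    qed
    ultimately show ?thesis using psubset.prems(4)[OF x] by simp
  qed simp
qed

text \<open>The cube \<open>[-p, p]\<^sup>m\<close> is cut into unit cubes and each unit cube into the simplices spanned by
  its monotone edge paths, where edges point away from the coordinate hyperplanes. In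
  \<open>(S, a, \<rho>)\<close>, the set \<open>S\<close> collects the negative coordinates, \<open>a\<close> holds the absolute values of the
  innermost corner, and coordinate \<open>i\<close> moves outwards in step \<open>\<rho> i\<close>. Orienting edges in this
  way makes the triangulation invariant under sign changes of coordinates.\<close>

definition simplices :: "nat \<Rightarrow> nat \<Rightarrow> (nat set \<times> (nat \<Rightarrow> nat) \<times> (nat \<Rightarrow> nat)) set"
  where "simplices m p = Pow {..<m} \<times> (PiE {..<m} (\<lambda>_. {..<p})) \<times> {\<rho>. \<rho> permutes {..<m}}"

fun vertex :: "nat \<Rightarrow> nat set \<times> (nat \<Rightarrow> nat) \<times> (nat \<Rightarrow> nat) \<Rightarrow> nat \<Rightarrow> nat \<Rightarrow> int"
  where "vertex m (S, a, \<rho>) j i =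
    (if i < m then (if i \<in> S then -1 else 1) * int (a i + of_bool (\<rho> i < j)) else 0)"

definition grid :: "nat \<Rightarrow> nat \<Rightarrow> (nat \<Rightarrow> int) set"
  where "grid m p = {x. (\<forall>i<m. \<bar>x i\<bar> \<le> int p) \<and> (\<forall>i\<ge>m. x i = 0)}"

text \<open>The antipodal map on the coordinates of block \<open>l\<close>; it identifies boundary
  points of that factor of the cube.\<close>

definition negate_block :: "(nat \<Rightarrow> nat) \<Rightarrow> nat \<Rightarrow> (nat \<Rightarrow> int) \<Rightarrow> nat \<Rightarrow> int"
  where "negate_block blk l x = (\<lambda>i. if blk i = l then - x i else x i)"

text \<open>The face map that leaves out vertex \<open>i\<close> of a simplex.\<close>

definition skip :: "nat \<Rightarrow> (nat \<Rightarrow> 'a) \<Rightarrow> nat \<Rightarrow> 'a"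
  where "skip i w j = (if j < i then w j else w (Suc j))"

lemma finite_simplices: "finite (simplices m p)"
  unfolding simplices_def by (intro finite_cartesian_product finite_PiE) (auto intro: finite_permutations)

lemma vertex_in_grid: "x \<in> simplices m p \<Longrightarrow> vertex m x j \<in> grid m p"
proof (cases x)
  case (fields S a \<rho>)
  assume "x \<in> simplices m p"
  then have "a i < p" if "i < m" for i
    using that fields by (auto simp: simplices_def)
  then show ?thesis unfolding fields grid_def
    by (auto simp: abs_mult less_imp_le) (metis Suc_leI of_nat_Suc of_nat_le_iff add.commute)
qed

section \<open>Cancellation of facets modulo 2\<close>

lemma permutes_lessThan_bound: "\<rho> permutes {..<m} \<Longrightarrow> \<rho> i < m \<longleftrightarrow> i < (m::nat)"
  by (metis lessThan_iff permutes_in_image)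

lemma permutes_eq_iff: "\<rho> permutes A \<Longrightarrow> \<rho> i = \<rho> j \<longleftrightarrow> i = j"
  by (metis permutes_inj injD)

text \<open>A cochain of dimension \<open>m - 1\<close> on the quotient of the cube: it reads only
  the \<open>m\<close> vertices of a facet, and it agrees on facets glued by an antipodal map, that
  is, where some coordinate of the block has absolute value \<open>p\<close> throughout.\<close>

definition facet_invariant :: "nat \<Rightarrow> nat \<Rightarrow> (nat \<Rightarrow> nat) \<Rightarrow> ((nat \<Rightarrow> nat \<Rightarrow> int) \<Rightarrow> bit) \<Rightarrow> bool"
  where "facet_invariant m p blk C \<longleftrightarrow>
    (\<forall>u u'. (\<forall>j<m. u j = u' j) \<longrightarrow> C u = C u') \<and>
    (\<forall>u i. i < m \<and> (\<forall>j<m. u j \<in> grid m p \<and> \<bar>u j i\<bar> = int p) \<longrightarrow>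
      C (\<lambda>j. negate_block blk (blk i) (u j)) = C u)"

lemma facet_cong: "facet_invariant m p blk C \<Longrightarrow> (\<And>j. j < m \<Longrightarrow> u j = u' j) \<Longrightarrow> C u = C u'"
  unfolding facet_invariant_def by blast

text \<open>Exchanging the steps \<open>i - 1\<close> and \<open>i\<close> of a path changes vertex
  \<open>i\<close> only, so the facets opposite vertex \<open>i\<close> occur in pairs.\<close>

lemma sum_inner_facets:
  assumes C: "facet_invariant m p blk C" and i: "0 < i" "i < m"
  shows "(\<Sum>x\<in>simplices m p. C (skip i (vertex m x))) = 0"
proof (rule sum_bit_involution[where f = "\<lambda>(S, a, \<rho>). (S, a, Transposition.transpose (i - 1) i \<circ> \<rho>)"])
  let ?f = "\<lambda>(S, a, \<rho>). (S :: nat set, a :: nat \<Rightarrow> nat, Transposition.transpose (i - 1) i \<circ> \<rho>)"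
  fix x :: "nat set \<times> (nat \<Rightarrow> nat) \<times> (nat \<Rightarrow> nat)" assume x: "x \<in> simplices m p"
  obtain S a \<rho> where xs: "x = (S, a, \<rho>)" by (cases x) auto
  have \<rho>: "\<rho> permutes {..<m}" using x xs by (auto simp: simplices_def)
  have t: "Transposition.transpose (i - 1) i permutes {..<m}" by (rule permutes_swap_id) (use i in auto)
  show "?f x \<in> simplices m p" using x permutes_compose[OF \<rho> t] by (auto simp: xs simplices_def)
  show "?f (?f x) = x" unfolding xs by (simp add: o_assoc[symmetric] fun_eq_iff)
  obtain q where q: "\<rho> q = i" using permutes_surj[OF \<rho>] by (metis surjD)
  have "(Transposition.transpose (i - 1) i \<circ> \<rho>) q \<noteq> \<rho> q" unfolding q comp_def using i by simp
  then have "Transposition.transpose (i - 1) i \<circ> \<rho> \<noteq> \<rho>" by metis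
  then show "?f x \<noteq> x" unfolding xs by (simp only: case_prod_conv prod.inject) simp
  have v: "vertex m (?f x) j = vertex m x j" if "j \<noteq> i" for j
  proof -
    have "(Transposition.transpose (i - 1) i r < j) = (r < j)" for r
      using that i unfolding Transposition.transpose_def by auto
    then show ?thesis unfolding xs by (auto simp: fun_eq_iff)
  qed
  show "C (skip i (vertex m (?f x))) = C (skip i (vertex m x))"
    by (rule facet_cong[OF C]) (simp add: skip_def v del: One_nat_def)
qed (rule finite_simplices)

text \<open>Here the first step reaches the boundary of the cube, so the facet opposite vertex 0
  lies in it. Negating the block of the coordinate moved first pairs this facet with the one glued
  to it.\<close>

lemma sum_first_facets_boundary:
  assumes C: "facet_invariant m p blk C"
  shows "(\<Sum>x\<in>{(S, a, \<rho>). (S, a, \<rho>) \<in> simplices m p \<and> (\<exists>i<m. \<rho> i = 0 \<and> Suc (a i) = p)}.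
    C (skip 0 (vertex m x))) = 0" (is "sum _ ?A = 0")
proof -
  define i0 where "i0 = (\<lambda>x :: nat set \<times> (nat \<Rightarrow> nat) \<times> (nat \<Rightarrow> nat). inv (snd (snd x)) 0)"
  let ?B = "\<lambda>x. {i. i < m \<and> blk i = blk (i0 x)}"
  let ?f = "\<lambda>x. (sym_diff (fst x) (?B x), snd x)"
  show ?thesis
  proof (rule sum_bit_involution[where f = ?f])
    show "finite ?A" by (rule finite_subset[OF _ finite_simplices[of m p]]) auto
  next
    fix x :: "nat set \<times> (nat \<Rightarrow> nat) \<times> (nat \<Rightarrow> nat)" assume x: "x \<in> ?A"
    obtain S a \<rho> where xs: "x = (S, a, \<rho>)" by (cases x) auto
    have S: "S \<subseteq> {..<m}" and \<rho>: "\<rho> permutes {..<m}" and xin: "x \<in> simplices m p"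
      using x xs by (auto simp: simplices_def)
    obtain i where i: "i < m" "\<rho> i = 0" "Suc (a i) = p" using x xs by auto
    have i0: "i0 x = i" unfolding i0_def xs using i(2) permutes_inverses(2)[OF \<rho>] by (metis snd_conv)
    show "?f x \<in> ?A" using x i unfolding xs by (auto simp: simplices_def)
    have "i \<in> ?B x" using i0 i by simp
    then show "?f x \<noteq> x" unfolding xs by auto
    show "?f (?f x) = x" unfolding xs i0_def by auto
    have v: "vertex m (?f x) j = negate_block blk (blk i) (vertex m x j)" for j
      unfolding negate_block_def using i0 unfolding xs by (auto simp: fun_eq_iff)
    have "C (skip 0 (vertex m (?f x))) = C (\<lambda>j. negate_block blk (blk i) (skip 0 (vertex m x) j))"
      by (rule facet_cong[OF C]) (simp add: skip_def v)
    also have "\<dots> = C (skip 0 (vertex m x))"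
    proof -
      have "skip 0 (vertex m x) j \<in> grid m p \<and> \<bar>skip 0 (vertex m x) j i\<bar> = int p" for j
        using vertex_in_grid[OF xin] i unfolding xs by (auto simp: skip_def abs_mult)
      then show ?thesis using C i(1) unfolding facet_invariant_def by blast
    qed
    finally show "C (skip 0 (vertex m (?f x))) = C (skip 0 (vertex m x))" .
  qed
qed

text \<open>Here the coordinate moved last starts at 0, so the facet opposite vertex
  \<open>m\<close> lies in a coordinate hyperplane. Reflecting that coordinate gives the other
  simplex with this facet.\<close>

lemma sum_last_facets_boundary:
  assumes C: "facet_invariant m p blk C"
  shows "(\<Sum>x\<in>{(S, a, \<rho>). (S, a, \<rho>) \<in> simplices m p \<and> (\<exists>i<m. Suc (\<rho> i) = m \<and> a i = 0)}.
    C (skip m (vertex m x))) = 0" (is "sum _ ?A = 0")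
proof -
  define i0 where "i0 = (\<lambda>x :: nat set \<times> (nat \<Rightarrow> nat) \<times> (nat \<Rightarrow> nat). inv (snd (snd x)) (m - 1))"
  let ?f = "\<lambda>x. (sym_diff (fst x) {i0 x}, snd x)"
  show ?thesis
  proof (rule sum_bit_involution[where f = ?f])
    show "finite ?A" by (rule finite_subset[OF _ finite_simplices[of m p]]) auto
  next
    fix x :: "nat set \<times> (nat \<Rightarrow> nat) \<times> (nat \<Rightarrow> nat)" assume x: "x \<in> ?A"
    obtain S a \<rho> where xs: "x = (S, a, \<rho>)" by (cases x) auto
    have S: "S \<subseteq> {..<m}" and \<rho>: "\<rho> permutes {..<m}" using x xs by (auto simp: simplices_def)
    obtain i where i: "i < m" "Suc (\<rho> i) = m" "a i = 0" using x xs by auto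
    have i0: "i0 x = i" unfolding i0_def xs using i(2) permutes_inverses(2)[OF \<rho>]
      by (metis snd_conv diff_Suc_1)
    show "?f x \<in> ?A" using x i i0 unfolding xs by (auto simp: simplices_def)
    show "?f x \<noteq> x" unfolding xs by auto
    show "?f (?f x) = x" unfolding xs i0_def by auto
    have v: "vertex m (?f x) j = vertex m x j" if "j < m" for j
      using that i i0 unfolding xs by (auto simp: fun_eq_iff)
    show "C (skip m (vertex m (?f x))) = C (skip m (vertex m x))"
      by (rule facet_cong[OF C]) (simp add: skip_def v)
  qed
qed

text \<open>Apart from the two families treated above, which sum to 0, the facet of a simplex
  opposite vertex 0 is the facet opposite vertex \<open>m\<close> of the next simplex
  outwards.\<close>

lemma sum_outer_facets:
  assumes C: "facet_invariant m p blk C" and m: "0 < m"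
  shows "(\<Sum>x\<in>simplices m p. C (skip 0 (vertex m x))) = (\<Sum>x\<in>simplices m p. C (skip m (vertex m x)))"
proof -
  let ?A = "{(S, a, \<rho>). (S, a, \<rho>) \<in> simplices m p \<and> (\<exists>i<m. \<rho> i = 0 \<and> Suc (a i) = p)}"
  let ?A' = "{(S, a, \<rho>). (S, a, \<rho>) \<in> simplices m p \<and> (\<exists>i<m. Suc (\<rho> i) = m \<and> a i = 0)}"
  let ?D = "simplices m p - ?A" and ?D' = "simplices m p - ?A'"
  \<comment> \<open>\<open>rot\<close> makes the first step the last one and advances the others.
    With \<open>a\<close> raised in the coordinate moved first, the old vertices
    \<open>1, ..., m\<close> become \<open>0, ..., m - 1\<close>.\<close>
  define rot where "rot r = (if r < m then (if r = 0 then m - 1 else r - 1) else r)" for r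
  define tor where "tor r = (if r < m then (if Suc r = m then 0 else Suc r) else r)" for r
  have rt: "rot (tor r) = r" "tor (rot r) = r" for r
    by (auto simp: rot_def tor_def)
  have rot: "rot permutes {..<m}" and tor: "tor permutes {..<m}"
    unfolding permutes_def by (metis (no_types, lifting) rt lessThan_iff rot_def tor_def)+
  let ?f = "\<lambda>(S, a, \<rho>). (S :: nat set, (\<lambda>i. if i < m then a i + of_bool (\<rho> i = 0) else a i :: nat), rot \<circ> \<rho>)"
  let ?g = "\<lambda>(S, a, \<rho>). (S :: nat set, (\<lambda>i. if i < m then a i - of_bool (Suc (\<rho> i) = m) else a i :: nat), tor \<circ> \<rho>)"
  have "(\<Sum>x\<in>?D. C (skip 0 (vertex m x))) = (\<Sum>x\<in>?D'. C (skip m (vertex m x)))"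
  proof (rule sum.reindex_bij_witness[where j = ?f and i = ?g])
    fix x assume x: "x \<in> ?D"
    obtain S a \<rho> where xs: "x = (S, a, \<rho>)" by (cases x) auto
    have S: "S \<subseteq> {..<m}" and a: "a \<in> PiE {..<m} (\<lambda>_. {..<p})" and \<rho>: "\<rho> permutes {..<m}"
      and b: "\<And>i. i < m \<Longrightarrow> \<rho> i = 0 \<Longrightarrow> Suc (a i) \<noteq> p"
      using x xs by (auto simp: simplices_def)
    have \<rho>m: "\<rho> i < m" if "i < m" for i using \<rho> that by (simp add: permutes_lessThan_bound)
    have am: "a i < p" if "i < m" for i using a that by auto
    have rr: "Suc (rot (\<rho> i)) = m \<longleftrightarrow> \<rho> i = 0" if "i < m" for i
      using \<rho>m[OF that] by (auto simp: rot_def)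
    show "?g (?f x) = x" unfolding xs using rr rt by (auto simp: fun_eq_iff)
    have "(\<lambda>i. if i < m then a i + of_bool (\<rho> i = 0) else a i) \<in> PiE {..<m} (\<lambda>_. {..<p})"
      using a b am by (auto simp: PiE_def extensional_def Pi_def) (metis Suc_lessI)
    moreover have "a i + of_bool (\<rho> i = 0) \<noteq> 0" if "i < m" "Suc (rot (\<rho> i)) = m" for i
      using rr that by simp
    ultimately show "?f x \<in> ?D'"
      unfolding xs using S permutes_compose[OF \<rho> rot]
      by (simp add: simplices_def)
    have v: "vertex m (?f x) j = vertex m x (Suc j)" if "j < m" for j
    proof -
      have "of_bool (\<rho> i = 0) + of_bool (rot (\<rho> i) < j) = (of_bool (\<rho> i < Suc j) :: nat)" if "i < m" for i
        using \<rho>m[OF that] \<open>j < m\<close> unfolding rot_def by auto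
      then show ?thesis unfolding xs by (auto simp: fun_eq_iff simp flip: of_nat_add)
    qed
    show "C (skip m (vertex m (?f x))) = C (skip 0 (vertex m x))"
      by (rule facet_cong[OF C]) (simp add: skip_def v)
  next
    fix x assume x: "x \<in> ?D'"
    obtain S a \<rho> where xs: "x = (S, a, \<rho>)" by (cases x) auto
    have S: "S \<subseteq> {..<m}" and a: "a \<in> PiE {..<m} (\<lambda>_. {..<p})" and \<rho>: "\<rho> permutes {..<m}"
      and b: "\<And>i. i < m \<Longrightarrow> Suc (\<rho> i) = m \<Longrightarrow> a i \<noteq> 0"
      using x xs by (auto simp: simplices_def)
    have \<rho>m: "\<rho> i < m" if "i < m" for i using \<rho> that by (simp add: permutes_lessThan_bound)
    have am: "a i < p" if "i < m" for i using a that by auto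
    have rr: "tor (\<rho> i) = 0 \<longleftrightarrow> Suc (\<rho> i) = m" if "i < m" for i
      using \<rho>m[OF that] by (auto simp: tor_def)
    show "?f (?g x) = x" unfolding xs using rr rt b by (auto simp: fun_eq_iff)
    have "(\<lambda>i. if i < m then a i - of_bool (Suc (\<rho> i) = m) else a i) \<in> PiE {..<m} (\<lambda>_. {..<p})"
      using a am by (auto simp: PiE_def extensional_def Pi_def less_imp_diff_less)
    moreover have "Suc (a i - 1) \<noteq> p" if "i < m" "Suc (\<rho> i) = m" for i
      using b[OF that] am[OF that(1)] by simp
    ultimately show "?g x \<in> ?D"
      unfolding xs using S permutes_compose[OF \<rho> tor] rr by (auto simp: simplices_def)
  qed
  moreover have sp: "(\<Sum>x\<in>simplices m p. c x) = (\<Sum>x\<in>?A. c x) + (\<Sum>x\<in>?D. c x)"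
    "(\<Sum>x\<in>simplices m p. c x) = (\<Sum>x\<in>?A'. c x) + (\<Sum>x\<in>?D'. c x)" for c :: "_ \<Rightarrow> bit"
    using sum.subset_diff[OF _ finite_simplices, of ?A m p c] sum.subset_diff[OF _ finite_simplices, of ?A' m p c]
    by (auto simp: add.commute)
  ultimately show ?thesis
    unfolding sp(1)[of "\<lambda>x. C (skip 0 (vertex m x))"] sp(2)[of "\<lambda>x. C (skip m (vertex m x))"]
    by (simp only: sum_first_facets_boundary[OF C] sum_last_facets_boundary[OF C])
qed

text \<open>The sum of all simplices is a cycle modulo 2 in the quotient, so coboundaries vanish on
  it. Middle facets cancel for each index separately; the facets opposite vertices 0 and
  \<open>m\<close> cancel each other.\<close>

lemma sum_facets_eq_0:
  assumes C: "facet_invariant m p blk C" and m: "0 < m"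
  shows "(\<Sum>x\<in>simplices m p. \<Sum>i\<le>m. C (skip i (vertex m x))) = 0"
proof -
  have "(\<Sum>x\<in>simplices m p. \<Sum>i\<le>m. C (skip i (vertex m x))) =
    (\<Sum>i\<le>m. \<Sum>x\<in>simplices m p. C (skip i (vertex m x)))" by (rule sum.swap)
  also have "\<dots> = (\<Sum>i\<in>{0, m}. \<Sum>x\<in>simplices m p. C (skip i (vertex m x)))"
    by (rule sum.mono_neutral_right) (auto intro!: sum_inner_facets[OF C])
  also have "\<dots> = 0" using m sum_outer_facets[OF C m] by simp
  finally show ?thesis .
qed

subsection \<open>Counting sign changes modulo 2\<close>

text \<open>A cup product of the 1-cocycles \<open>g l\<close> is a cocycle: it sums to 0 over all
  \<open>t + 2\<close> facets of the simplex \<open>w 0, ..., w (t + 1)\<close>. The right side is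
  the facet opposite the last vertex.\<close>

lemma sum_prod_skip:
  fixes g :: "nat \<Rightarrow> 'a \<Rightarrow> 'a \<Rightarrow> bit"
  assumes g: "\<And>l x y z. g l x z = g l x y + g l y z"
  shows "(\<Sum>i\<le>t. \<Prod>l<t. g l (skip i w l) (skip i w (Suc l))) = (\<Prod>l<t. g l (w l) (w (Suc l)))"
proof (induction t)
  case (Suc t)
  let ?P = "\<Prod>l<t. g l (w l) (w (Suc l))"
  let ?z = "w (Suc (Suc t))"
  have "(\<Sum>i\<le>Suc t. \<Prod>l<Suc t. g l (skip i w l) (skip i w (Suc l))) =
    (\<Sum>i\<le>t. (\<Prod>l<t. g l (skip i w l) (skip i w (Suc l))) * g t (w (Suc t)) ?z) + ?P * g t (w t) ?z"
    by (simp add: skip_def)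
  also have "\<dots> = ?P * g t (w (Suc t)) ?z + ?P * g t (w t) ?z"
    by (simp add: Suc.IH sum_distrib_right[symmetric])
  also have "\<dots> = ?P * (g t (w t) (w (Suc t)) + (g t (w (Suc t)) ?z + g t (w (Suc t)) ?z))"
    using g[of t "w t" ?z "w (Suc t)"] by (simp only: distrib_left ac_simps)
  finally show ?case by simp
qed (simp add: skip_def)

text \<open>The same cocycle identity, solved for the facet opposite vertex 0.\<close>

lemma sum_prod_skip_tail:
  fixes g :: "nat \<Rightarrow> 'a \<Rightarrow> 'a \<Rightarrow> bit"
  assumes g: "\<And>l x y z. g l x z = g l x y + g l y z"
  shows "(\<Sum>i\<le>t. \<Prod>l<t. g l (skip (Suc i) w l) (skip (Suc i) w (Suc l))) =
    (\<Prod>l<t. g l (w (Suc l)) (w (Suc (Suc l))))"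
proof -
  let ?c = "\<lambda>i. \<Prod>l<t. g l (skip i w l) (skip i w (Suc l))"
  have "(\<Prod>l<t. g l (w (Suc l)) (w (Suc (Suc l)))) + (\<Sum>i\<le>t. ?c (Suc i)) = (\<Sum>i\<le>Suc t. ?c i)"
    unfolding sum.atMost_Suc_shift by (simp add: skip_def)
  also have "\<dots> = (\<Prod>l<t. g l (w l) (w (Suc l))) + ?c (Suc t)"
    by (simp add: sum_prod_skip[of g w t, OF g])
  also have "?c (Suc t) = (\<Prod>l<t. g l (w l) (w (Suc l)))"
    by (rule prod.cong) (auto simp: skip_def)
  finally have "(\<Prod>l<t. g l (w (Suc l)) (w (Suc (Suc l)))) + (\<Sum>i\<le>t. ?c (Suc i)) = 0"
    by simp
  then show ?thesis by (simp add: bit_add_eq_0_iff)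
qed

text \<open>The cochain whose coboundary accounts for replacing \<open>\<sigma> t\<close> by \<open>\<sigma> t + h\<close>.\<close>

definition insert_cochain ::
    "nat \<Rightarrow> nat \<Rightarrow> (nat \<Rightarrow> 'a \<Rightarrow> bit) \<Rightarrow> ('a \<Rightarrow> bit) \<Rightarrow> (nat \<Rightarrow> 'a) \<Rightarrow> bit"
  where "insert_cochain m t \<sigma> h u =
    (\<Prod>l<t. \<sigma> l (u l) + \<sigma> l (u (Suc l))) * h (u t) *
    (\<Prod>l<m - Suc t. \<sigma> (Suc t + l) (u (t + l)) + \<sigma> (Suc t + l) (u (Suc (t + l))))"

lemma bit_cocycle: "(f x :: bit) + f z = (f x + f y) + (f y + f z)"
  by (cases "f x"; cases "f y"; cases "f z") simp_all

text \<open>The Leibniz rule: the factors around \<open>h\<close> are cocycles, so only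
  \<open>h\<close> is differentiated. Facets opposite vertices up to \<open>t\<close> see
  \<open>h\<close> at \<open>w (t + 1)\<close> and collapse the front product; the others see it at
  \<open>w t\<close> and collapse the back product.\<close>

lemma coboundary_insert_cochain:
  assumes "t < m"
  shows "(\<Sum>i\<le>m. insert_cochain m t \<sigma> h (skip i w)) =
    (\<Prod>l<t. \<sigma> l (w l) + \<sigma> l (w (Suc l))) * (h (w t) + h (w (Suc t))) *
    (\<Prod>l<m - Suc t. \<sigma> (Suc t + l) (w (Suc t + l)) + \<sigma> (Suc t + l) (w (Suc (Suc t + l))))"
proof -
  obtain q where m: "m = Suc t + q" using assms by (metis less_iff_Suc_add add_Suc)
  let ?c = "\<lambda>i. insert_cochain m t \<sigma> h (skip i w)"
  let ?P = "\<Prod>l<t. \<sigma> l (w l) + \<sigma> l (w (Suc l))"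
  let ?T = "\<Prod>l<q. \<sigma> (Suc t + l) (w (Suc t + l)) + \<sigma> (Suc t + l) (w (Suc (Suc t + l)))"
  have split: "(\<Sum>i\<le>m. f i) = (\<Sum>i\<le>t. f i) + (\<Sum>i\<le>q. f (t + Suc i))" for f :: "nat \<Rightarrow> bit"
    unfolding m by (induction q) (simp_all add: add.assoc)
  have "?c i = (\<Prod>l<t. \<sigma> l (skip i w l) + \<sigma> l (skip i w (Suc l))) * (h (w (Suc t)) * ?T)" if "i \<le> t" for i
    using that by (simp add: insert_cochain_def m skip_def mult.assoc)
  then have 1: "(\<Sum>i\<le>t. ?c i) = ?P * (h (w (Suc t)) * ?T)"
    using sum_prod_skip[of "\<lambda>l x y. \<sigma> l x + \<sigma> l y" w t]
    by (simp add: sum_distrib_right[symmetric] bit_cocycle[symmetric])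
  let ?y = "\<lambda>j. w (t + j)"
  have "?c (t + Suc i) = ?P * h (w t) *
    (\<Prod>l<q. \<sigma> (Suc t + l) (skip (Suc i) ?y l) + \<sigma> (Suc t + l) (skip (Suc i) ?y (Suc l)))" for i
    by (simp add: insert_cochain_def m skip_def cong: if_cong)
  then have 2: "(\<Sum>i\<le>q. ?c (t + Suc i)) = ?P * h (w t) * ?T"
    using sum_prod_skip_tail[of "\<lambda>l x y. \<sigma> (Suc t + l) x + \<sigma> (Suc t + l) y" ?y q]
    by (simp add: sum_distrib_left[symmetric] bit_cocycle[symmetric])
  have "(\<Sum>i\<le>m. ?c i) = ?P * (h (w t) + h (w (Suc t))) * ?T"
    unfolding split 1 2 by (simp add: algebra_simps)
  then show ?thesis by (simp add: m)
qed

text \<open>The cup product of the coboundaries of \<open>\<sigma> 0, ..., \<sigma> (m - 1)\<close>,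
  evaluated on the sum of all simplices.\<close>

definition crossings :: "nat \<Rightarrow> nat \<Rightarrow> (nat \<Rightarrow> (nat \<Rightarrow> int) \<Rightarrow> bit) \<Rightarrow> bit"
  where "crossings m p \<sigma> =
    (\<Sum>x\<in>simplices m p. \<Prod>t<m. \<sigma> t (vertex m x t) + \<sigma> t (vertex m x (Suc t)))"

text \<open>Signs are coded as bits: \<open>v l = 1\<close> means odd and \<open>v l = 0\<close>
  even under the antipodal map of block \<open>l\<close>, on the boundary of that factor.\<close>

definition equivariant :: "nat \<Rightarrow> nat \<Rightarrow> (nat \<Rightarrow> nat) \<Rightarrow> (nat \<Rightarrow> bit) \<Rightarrow> ((nat \<Rightarrow> int) \<Rightarrow> bit) \<Rightarrow> bool"
  where "equivariant m p blk v f \<longleftrightarrow> (\<forall>x\<in>grid m p. \<forall>i<m. \<bar>x i\<bar> = int p \<longrightarrow>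
    f (negate_block blk (blk i) x) = f x + v (blk i))"

text \<open>The parity of \<open>\<sigma> l\<close> cancels in a sum of two of its values, and the
  remaining factor \<open>h\<close> is even in every block.\<close>

lemma facet_invariant_insert_cochain:
  assumes t: "t < m" and \<sigma>: "\<And>l. l < m \<Longrightarrow> equivariant m p blk (v l) (\<sigma> l)"
    and h: "equivariant m p blk (\<lambda>_. 0) h"
  shows "facet_invariant m p blk (insert_cochain m t \<sigma> h)"
  unfolding facet_invariant_def
proof (intro conjI allI impI)
  fix u u' :: "nat \<Rightarrow> nat \<Rightarrow> int" assume *: "\<forall>j<m. u j = u' j"
  show "insert_cochain m t \<sigma> h u = insert_cochain m t \<sigma> h u'"
    unfolding insert_cochain_def
    by (intro arg_cong2[where f = "(*)"] prod.cong refl) (use t in \<open>auto simp: *\<close>)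
next
  fix u :: "nat \<Rightarrow> nat \<Rightarrow> int" and i
  assume *: "i < m \<and> (\<forall>j<m. u j \<in> grid m p \<and> \<bar>u j i\<bar> = int p)"
  let ?n = "negate_block blk (blk i)"
  have \<sigma>': "\<sigma> l (?n (u j)) + \<sigma> l (?n (u j')) = \<sigma> l (u j) + \<sigma> l (u j')"
    if "l < m" "j < m" "j' < m" for l j j'
  proof -
    have "\<sigma> l (?n (u j)) = \<sigma> l (u j) + v l (blk i)" "\<sigma> l (?n (u j')) = \<sigma> l (u j') + v l (blk i)"
      using * \<sigma>[OF that(1)] that unfolding equivariant_def by auto
    then show ?thesis by (cases "v l (blk i)") simp_all
  qed
  have h': "h (?n (u j)) = h (u j)" if "j < m" for j
    using * h that unfolding equivariant_def by auto
  show "insert_cochain m t \<sigma> h (\<lambda>j. ?n (u j)) = insert_cochain m t \<sigma> h u"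
    unfolding insert_cochain_def
    by (intro arg_cong2[where f = "(*)"] prod.cong refl) (use t in \<open>auto simp: \<sigma>' h'\<close>)
qed

lemma prod_split_at:
  fixes f :: "nat \<Rightarrow> 'a :: comm_monoid_mult"
  assumes "t < m"
  shows "(\<Prod>l<m. f l) = (\<Prod>l<t. f l) * f t * (\<Prod>l<m - Suc t. f (Suc t + l))"
proof -
  obtain q where m: "m = Suc t + q" using assms by (metis less_iff_Suc_add add_Suc)
  show ?thesis unfolding m by (induction q) (simp_all add: mult_ac)
qed

text \<open>The two counts differ by a coboundary, that of \<open>insert_cochain\<close> with
  \<open>h = \<sigma> t + \<tau>\<close>; this \<open>h\<close> is even because both summands have
  parity \<open>v t\<close>.\<close>

lemma crossings_update:
  assumes t: "t < m" and \<sigma>: "\<And>l. l < m \<Longrightarrow> equivariant m p blk (v l) (\<sigma> l)"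
    and \<tau>: "equivariant m p blk (v t) \<tau>"
  shows "crossings m p (\<sigma>(t := \<tau>)) = crossings m p \<sigma>"
proof -
  define h where "h = (\<lambda>x. \<sigma> t x + \<tau> x)"
  have h: "equivariant m p blk (\<lambda>_. 0) h"
    using \<sigma>[OF t] \<tau> unfolding equivariant_def h_def
    by (auto simp: ac_simps)
  have "crossings m p \<sigma> + crossings m p (\<sigma>(t := \<tau>)) =
    (\<Sum>x\<in>simplices m p. \<Sum>i\<le>m. insert_cochain m t \<sigma> h (skip i (vertex m x)))"
    unfolding crossings_def sum.distrib[symmetric]
  proof (rule sum.cong[OF refl])
    fix x
    let ?w = "vertex m x"
    show "(\<Prod>l<m. \<sigma> l (?w l) + \<sigma> l (?w (Suc l))) +
        (\<Prod>l<m. (\<sigma>(t := \<tau>)) l (?w l) + (\<sigma>(t := \<tau>)) l (?w (Suc l))) =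
      (\<Sum>i\<le>m. insert_cochain m t \<sigma> h (skip i ?w))"
      unfolding coboundary_insert_cochain[OF t] prod_split_at[OF t] h_def
      by (simp add: algebra_simps)
  qed
  also have "\<dots> = 0"
    by (rule sum_facets_eq_0[OF facet_invariant_insert_cochain[OF t \<sigma> h]]) (use t in auto)
  finally show ?thesis by (simp add: bit_add_eq_0_iff)
qed

lemma crossings_unique:
  assumes \<sigma>: "\<And>l. l < m \<Longrightarrow> equivariant m p blk (v l) (\<sigma> l)"
    and \<tau>: "\<And>l. l < m \<Longrightarrow> equivariant m p blk (v l) (\<tau> l)"
  shows "crossings m p \<tau> = crossings m p \<sigma>"
proof -
  \<comment> \<open>The functions are exchanged one index at a time; in \<open>?f j\<close> those
    below \<open>j\<close> are exchanged.\<close>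
  let ?f = "\<lambda>j l. if l < j then \<tau> l else \<sigma> l"
  have "crossings m p (?f j) = crossings m p \<sigma>" if "j \<le> m" for j
    using that
  proof (induction j)
    case (Suc j)
    have "?f (Suc j) = (?f j)(j := \<tau> j)" by (auto simp: fun_eq_iff)
    then have "crossings m p (?f (Suc j)) = crossings m p ((?f j)(j := \<tau> j))" by (rule arg_cong)
    also have "\<dots> = crossings m p (?f j)"
      by (rule crossings_update[where blk = blk and v = v]) (use Suc.prems \<sigma> \<tau> in auto)
    finally show ?case using Suc by simp
  qed simp
  from this[of m] have "crossings m p (?f m) = crossings m p \<sigma>" by simp
  moreover have "crossings m p (?f m) = crossings m p \<tau>"
    unfolding crossings_def by (intro sum.cong prod.cong) auto
  ultimately show ?thesis by simp
qed

section \<open>A model sign pattern with exactly one crossing simplex\<close>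

definition leading_sign :: "nat \<Rightarrow> (nat \<Rightarrow> nat) \<Rightarrow> nat \<Rightarrow> (nat \<Rightarrow> int) \<Rightarrow> bit"
  where "leading_sign m blk l x = of_bool (\<exists>i<m. blk i = l \<and> x i > 0 \<and>
    (\<forall>r. i < r \<and> r < m \<and> blk r = l \<longrightarrow> x r = 0))"

lemma leading_sign_eq:
  assumes "i < m" "blk i = l" "x i \<noteq> 0" "\<And>r. i < r \<Longrightarrow> r < m \<Longrightarrow> blk r = l \<Longrightarrow> x r = 0"
  shows "leading_sign m blk l x = of_bool (x i > 0)"
proof -
  have "(\<exists>j<m. blk j = l \<and> x j > 0 \<and> (\<forall>r. j < r \<and> r < m \<and> blk r = l \<longrightarrow> x r = 0)) \<longleftrightarrow> x i > 0"
  proof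
    assume "\<exists>j<m. blk j = l \<and> x j > 0 \<and> (\<forall>r. j < r \<and> r < m \<and> blk r = l \<longrightarrow> x r = 0)"
    then obtain j where j: "j < m" "blk j = l" "x j > 0" "\<And>r. j < r \<Longrightarrow> r < m \<Longrightarrow> blk r = l \<Longrightarrow> x r = 0"
      by blast
    have "\<not> i < j" "\<not> j < i" using assms(4)[of j] j(4)[of i] j(1-3) assms(1-3) by auto
    then show "x i > 0" using j(3) by (metis linorder_neqE_nat)
  qed (use assms in blast)
  then show ?thesis unfolding leading_sign_def by simp
qed

lemma leading_sign_zero:
  "(\<And>i. i < m \<Longrightarrow> blk i = l \<Longrightarrow> x i = 0) \<Longrightarrow> leading_sign m blk l x = 0"
  unfolding leading_sign_def by auto

lemma leading_index_exists:
  fixes x :: "nat \<Rightarrow> int"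
  assumes "i < m" "blk i = l" "x i \<noteq> 0"
  obtains r where "r < m" "blk r = l" "x r \<noteq> 0" "\<And>r'. r < r' \<Longrightarrow> r' < m \<Longrightarrow> blk r' = l \<Longrightarrow> x r' = 0"
proof -
  let ?A = "{i. i < m \<and> blk i = l \<and> x i \<noteq> 0}"
  have fin: "finite ?A" by (rule finite_subset[of _ "{..<m}"]) auto
  have "Max ?A \<in> ?A" by (rule Max_in) (use assms in auto)
  moreover have "r' \<le> Max ?A" if "r' \<in> ?A" for r' by (rule Max_ge[OF fin that])
  ultimately show thesis using that[of "Max ?A"] by (metis (mono_tags, lifting) leD mem_Collect_eq)
qed

lemma leading_sign_cong:
  assumes "\<And>i. i < m \<Longrightarrow> blk i = l \<Longrightarrow> y i > 0 \<longleftrightarrow> x i > 0"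
    and "\<And>i. i < m \<Longrightarrow> blk i = l \<Longrightarrow> y i = 0 \<longleftrightarrow> x i = 0"
  shows "leading_sign m blk l y = leading_sign m blk l x"
  unfolding leading_sign_def by (rule arg_cong[where f = of_bool], rule iffI) (use assms in blast)+

text \<open>The last nonzero coordinate of the block decides. It exists on the boundary of the block
  as \<open>p > 0\<close>, and the antipodal map reverses its sign; negating another block leaves it
  alone.\<close>

lemma equivariant_leading_sign:
  assumes p: "p > 0"
  shows "equivariant m p blk (\<lambda>r. of_bool (r = l)) (leading_sign m blk l)"
  unfolding equivariant_def
proof (intro ballI allI impI)
  fix x i assume x: "x \<in> grid m p" and i: "i < m" "\<bar>x i\<bar> = int p"
  show "leading_sign m blk l (negate_block blk (blk i) x) = leading_sign m blk l x + of_bool (blk i = l)"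
  proof (cases "blk i = l")
    case True
    obtain r where r: "r < m" "blk r = l" "x r \<noteq> 0" "\<And>r'. r < r' \<Longrightarrow> r' < m \<Longrightarrow> blk r' = l \<Longrightarrow> x r' = 0"
      using leading_index_exists[of i m blk l x] i True p by (metis abs_0 less_irrefl of_nat_0_eq_iff)
    have "leading_sign m blk l x = of_bool (x r > 0)"
      by (rule leading_sign_eq) (use r in auto)
    moreover have "leading_sign m blk l (negate_block blk l x) = of_bool (negate_block blk l x r > 0)"
      by (rule leading_sign_eq) (use r in \<open>auto simp: negate_block_def\<close>)
    ultimately show ?thesis using r True by (auto simp: negate_block_def)
  next
    case False
    then have "leading_sign m blk l (negate_block blk (blk i) x) = leading_sign m blk l x"
      by (intro leading_sign_cong) (auto simp: negate_block_def)
    then show ?thesis using False by simp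
  qed
qed

text \<open>Each leading sign is odd in its own block and even in the others, so this combination
  has parity \<open>v\<close>.\<close>

definition model_sign :: "nat \<Rightarrow> (nat \<Rightarrow> nat) \<Rightarrow> (nat \<Rightarrow> bit) \<Rightarrow> (nat \<Rightarrow> int) \<Rightarrow> bit"
  where "model_sign m blk v x = (\<Sum>l\<in>blk ` {..<m}. v l * leading_sign m blk l x)"

lemma equivariant_model_sign:
  assumes p: "p > 0"
  shows "equivariant m p blk v (model_sign m blk v)"
  unfolding equivariant_def
proof (intro ballI allI impI)
  fix x i assume x: "x \<in> grid m p" and i: "i < m" "\<bar>x i\<bar> = int p"
  have "leading_sign m blk l (negate_block blk (blk i) x) = leading_sign m blk l x + of_bool (blk i = l)" for l
    using equivariant_leading_sign[OF p] x i unfolding equivariant_def by blast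
  then have "model_sign m blk v (negate_block blk (blk i) x) =
    model_sign m blk v x + (\<Sum>l\<in>blk ` {..<m}. v l * of_bool (blk i = l))"
    unfolding model_sign_def by (simp add: distrib_left sum.distrib)
  also have "(\<Sum>l\<in>blk ` {..<m}. v l * of_bool (blk i = l)) = v (blk i)"
    using i by (simp add: of_bool_def if_distrib cong: if_cong)
  finally show "model_sign m blk v (negate_block blk (blk i) x) = model_sign m blk v x + v (blk i)" .
qed

lemma leading_sign_other_block:
  assumes "\<And>i. i < m \<Longrightarrow> i \<noteq> c \<Longrightarrow> y i = x i" "l \<noteq> blk c"
  shows "leading_sign m blk l y = leading_sign m blk l x"
proof -
  have "y i = x i" if "i < m" "blk i = l" for i using assms that by blast
  then show ?thesis by (intro leading_sign_cong) auto
qed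

lemma leading_sign_sgn_cong:
  assumes "\<And>i. i < m \<Longrightarrow> sgn (y i) = sgn (x i)"
  shows "leading_sign m blk l y = leading_sign m blk l x"
proof -
  have "(y i > 0) = (x i > 0)" "(y i = 0) = (x i = 0)" if "i < m" for i
    using assms[OF that] by (auto simp: sgn_if split: if_splits)
  then show ?thesis by (intro leading_sign_cong) auto
qed

lemma leading_sign_below:
  assumes y: "\<And>i. i < m \<Longrightarrow> i \<noteq> c \<Longrightarrow> y i = x i" and r: "c < r" "r < m" "blk r = blk c" "x r \<noteq> 0"
  shows "leading_sign m blk (blk c) y = leading_sign m blk (blk c) x"
proof -
  obtain q where q: "q < m" "blk q = blk c" "x q \<noteq> 0"
    "\<And>r'. q < r' \<Longrightarrow> r' < m \<Longrightarrow> blk r' = blk c \<Longrightarrow> x r' = 0"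
    using leading_index_exists[of r m blk "blk c" x] r by auto
  have "c < q" using q(4)[of r] r by fastforce
  have "leading_sign m blk (blk c) x = of_bool (x q > 0)"
    by (rule leading_sign_eq) (use q in auto)
  moreover have "leading_sign m blk (blk c) y = of_bool (y q > 0)"
    by (rule leading_sign_eq) (use q y \<open>c < q\<close> in auto)
  ultimately show ?thesis using y q \<open>c < q\<close> by simp
qed

text \<open>Moving coordinate \<open>c\<close> can affect only the leading sign of its own block;
  all other summands cancel.\<close>

lemma model_sign_step:
  assumes y: "\<And>i. i < m \<Longrightarrow> i \<noteq> c \<Longrightarrow> y i = x i" and c: "c < m"
  shows "model_sign m blk v x + model_sign m blk v y =
    v (blk c) * (leading_sign m blk (blk c) x + leading_sign m blk (blk c) y)"
proof -
  have "model_sign m blk v x + model_sign m blk v y =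
    (\<Sum>l\<in>blk ` {..<m}. v l * (leading_sign m blk l x + leading_sign m blk l y))"
    unfolding model_sign_def by (simp add: distrib_left sum.distrib)
  also have "\<dots> = (\<Sum>l\<in>{blk c}. v l * (leading_sign m blk l x + leading_sign m blk l y))"
    by (rule sum.mono_neutral_right)
      (use c in \<open>auto simp: leading_sign_other_block[OF y] bit_add_self\<close>)
  finally show ?thesis by simp
qed

text \<open>Says which coordinates are positive in the crossing simplex: each block starts with a
  positive one, and signs alternate within it.\<close>

fun alternating :: "(nat \<Rightarrow> nat) \<Rightarrow> nat \<Rightarrow> bool"
  where "alternating blk 0 = True"
  | "alternating blk (Suc t) = (blk t = blk (Suc t) \<longrightarrow> \<not> alternating blk t)"

text \<open>A crossing in the step that moves \<open>c\<close> needs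
  \<open>v (\<rho> c) (blk c) = 1\<close> and a change of the leading sign of its block. The first
  makes \<open>\<rho>\<close> preserve blocks; the second makes the path start at the origin and run
  through each block in increasing order.\<close>

lemma crossing_simplex_unique:
  assumes mono: "\<And>i j. i \<le> j \<Longrightarrow> j < m \<Longrightarrow> blk i \<le> blk j"
    and v0: "\<And>t l. t < m \<Longrightarrow> l < blk t \<Longrightarrow> v t l = 0"
    and x: "(S, a, \<rho>) \<in> simplices m p"
    and cross: "\<And>t. t < m \<Longrightarrow> model_sign m blk (v t) (vertex m (S, a, \<rho>) t) +
      model_sign m blk (v t) (vertex m (S, a, \<rho>) (Suc t)) \<noteq> 0"
  shows "a = (\<lambda>i\<in>{..<m}. 0)" "\<rho> = id"
proof -
  let ?w = "vertex m (S, a, \<rho>)"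
  have S: "S \<subseteq> {..<m}" and a: "a \<in> PiE {..<m} (\<lambda>_. {..<p})" and \<rho>: "\<rho> permutes {..<m}"
    using x by (auto simp: simplices_def)
  have w: "?w (Suc (\<rho> c)) i = ?w (\<rho> c) i" if "i < m" "i \<noteq> c" for c i
    using that permutes_eq_iff[OF \<rho>, of i c] by (simp add: less_Suc_eq)
  have step: "v (\<rho> c) (blk c) \<noteq> 0"
    "leading_sign m blk (blk c) (?w (Suc (\<rho> c))) \<noteq> leading_sign m blk (blk c) (?w (\<rho> c))"
    if c: "c < m" for c
  proof -
    have "\<rho> c < m" using c permutes_lessThan_bound[OF \<rho>] by simp
    from cross[OF this] have "v (\<rho> c) (blk c) *
        (leading_sign m blk (blk c) (?w (\<rho> c)) + leading_sign m blk (blk c) (?w (Suc (\<rho> c)))) \<noteq> 0"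
      by (subst (asm) model_sign_step[OF w c]) simp_all
    then show "v (\<rho> c) (blk c) \<noteq> 0"
      "leading_sign m blk (blk c) (?w (Suc (\<rho> c))) \<noteq> leading_sign m blk (blk c) (?w (\<rho> c))"
      using bit_add_self(1) by (metis mult_zero_left, metis mult_zero_right)
  qed
  have ge: "blk (\<rho> c) \<le> blk c" if "c \<in> {..<m}" for c
    using step(1)[of c] v0[of "\<rho> c" "blk c"] that permutes_lessThan_bound[OF \<rho>, of c]
    by (metis lessThan_iff not_less)
  \<comment> \<open>As \<open>\<rho>\<close> is a permutation, both sides of
    \<open>blk (\<rho> c) \<le> blk c\<close> have the same total, so each inequality is an
    equality.\<close>
  have "(\<Sum>c<m. blk (\<rho> c)) = (\<Sum>c<m. blk c)"
    using sum.permute[OF \<rho>, of blk] by (simp add: comp_def)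
  then have blk: "blk (\<rho> c) = blk c" if "c < m" for c
    using sum_mono_inv[of "\<lambda>c. blk (\<rho> c)" "{..<m}" blk c] ge that by auto
  \<comment> \<open>A coordinate that is nonzero before its step moves away from 0, and no sign
    changes.\<close>
  have a0: "a c = 0" if c: "c < m" for c
  proof (rule ccontr)
    assume "a c \<noteq> 0"
    then have "sgn (?w (Suc (\<rho> c)) i) = sgn (?w (\<rho> c) i)" if "i < m" for i
    proof (cases "i = c")
      case True
      then show ?thesis using c \<open>a c \<noteq> 0\<close> by (auto simp: sgn_mult simp flip: of_nat_Suc)
    next
      case False
      then show ?thesis by (simp only: w[OF that False])
    qed
    then show False
      using step(2)[OF c] leading_sign_sgn_cong[of m "?w (Suc (\<rho> c))" "?w (\<rho> c)" blk "blk c"] by blast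
  qed
  then show "a = (\<lambda>i\<in>{..<m}. 0)" using PiE_arb[OF a] by (intro ext) (simp add: restrict_def)
  \<comment> \<open>In the same block, a nonzero coordinate \<open>r > c\<close> would decide the
    leading sign and hide the step in \<open>c\<close>; so \<open>r\<close> moves later. Across
    blocks the order follows from \<open>mono\<close>.\<close>
  have less: "\<rho> c < \<rho> r" if "c < r" "r < m" for c r
  proof (cases "blk c = blk r")
    case True
    have "?w (\<rho> c) r = 0"
    proof (rule ccontr)
      assume "?w (\<rho> c) r \<noteq> 0"
      then have "leading_sign m blk (blk c) (?w (Suc (\<rho> c))) = leading_sign m blk (blk c) (?w (\<rho> c))"
        by (intro leading_sign_below[of m c _ _ r]) (use w that True in auto)
      then show False using step(2)[of c] that by simp
    qed
    then have "\<rho> c \<le> \<rho> r" using that by (cases "\<rho> r < \<rho> c") (auto split: if_splits)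
    then show ?thesis using permutes_eq_iff[OF \<rho>, of c r] that by simp
  next
    case False
    then have "blk (\<rho> c) < blk (\<rho> r)" using mono[of c r] blk[of c] blk[of r] that by simp
    then show ?thesis
      using mono[of "\<rho> r" "\<rho> c"] permutes_lessThan_bound[OF \<rho>, of c] that by (meson leD less_trans not_less)
  qed
  have "c \<le> \<rho> c" if "c < m" for c
    using that
  proof (induction c)
    case (Suc c)
    then show ?case using less[of c "Suc c"] by simp
  qed simp
  then show "\<rho> = id" using permutes_natset_ge[OF \<rho>] by auto
qed

text \<open>Step \<open>t\<close> makes coordinate \<open>t\<close> the leading one of its block.
  Before it, \<open>t - 1\<close> leads if it lies in the same block; otherwise the block is still
  zero and its leading sign is 0, as if negative.\<close>

lemma crossing_straight_path:
  assumes mono: "\<And>i j. i \<le> j \<Longrightarrow> j < m \<Longrightarrow> blk i \<le> blk j"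
    and v: "v t (blk t) = 1" and t: "t < m"
  shows "model_sign m blk (v t) (vertex m (S, (\<lambda>i\<in>{..<m}. 0), id) t) +
      model_sign m blk (v t) (vertex m (S, (\<lambda>i\<in>{..<m}. 0), id) (Suc t)) =
    of_bool (t \<in> S \<longleftrightarrow> 0 < t \<and> blk (t - 1) = blk t \<and> t - 1 \<notin> S)"
proof -
  let ?w = "vertex m (S, (\<lambda>i\<in>{..<m}. 0), id)"
  have "?w (Suc t) i = ?w t i" if "i < m" "i \<noteq> t" for i
    using that by auto
  then have "model_sign m blk (v t) (?w t) + model_sign m blk (v t) (?w (Suc t)) =
      leading_sign m blk (blk t) (?w t) + leading_sign m blk (blk t) (?w (Suc t))"
    using model_sign_step[of m t "?w (Suc t)" "?w t" blk "v t"] t v by simp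
  moreover have "leading_sign m blk (blk t) (?w (Suc t)) = of_bool (?w (Suc t) t > 0)"
    by (rule leading_sign_eq) (use t in auto)
  moreover have "leading_sign m blk (blk t) (?w t) = of_bool (0 < t \<and> blk (t - 1) = blk t \<and> t - 1 \<notin> S)"
  proof (cases "0 < t \<and> blk (t - 1) = blk t")
    case True
    have "leading_sign m blk (blk t) (?w t) = of_bool (?w t (t - 1) > 0)"
      by (rule leading_sign_eq) (use t True in auto)
    then show ?thesis using True t by auto
  next
    case False
    have "blk i \<noteq> blk t" if "i < t" for i
      using mono[of i "t - 1"] mono[of "t - 1" t] False that t by fastforce
    then have "leading_sign m blk (blk t) (?w t) = 0"
      by (intro leading_sign_zero) (use t in auto)
    then show ?thesis using False by auto
  qed
  moreover have "?w (Suc t) t > 0 \<longleftrightarrow> t \<notin> S" using t by simp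
  ultimately show ?thesis
    by (cases "t \<in> S"; cases "0 < t \<and> blk (t - 1) = blk t \<and> t - 1 \<notin> S")
      (simp_all only: of_bool_eq simp_thms add_0_left add_0_right one_add_one bit_2_eq_0)
qed

lemma crossings_model_sign:
  assumes p: "p > 0"
    and mono: "\<And>i j. i \<le> j \<Longrightarrow> j < m \<Longrightarrow> blk i \<le> blk j"
    and v0: "\<And>t l. t < m \<Longrightarrow> l < blk t \<Longrightarrow> v t l = 0"
    and v1: "\<And>t. t < m \<Longrightarrow> v t (blk t) = 1"
  shows "crossings m p (\<lambda>t. model_sign m blk (v t)) = 1"
proof -
  let ?z = "\<lambda>i\<in>{..<m}. 0 :: nat"
  let ?S = "{t. t < m \<and> \<not> alternating blk t}"
  let ?c = "\<lambda>x t. model_sign m blk (v t) (vertex m x t) + model_sign m blk (v t) (vertex m x (Suc t))"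
  have straight: "?c (S, ?z, id) t = of_bool (t \<in> S \<longleftrightarrow> 0 < t \<and> blk (t - 1) = blk t \<and> t - 1 \<notin> S)"
    if "t < m" for t S
    by (rule crossing_straight_path) (use mono v1 that in auto)
  have x0: "(?S, ?z, id) \<in> simplices m p"
    unfolding simplices_def using p by (auto simp: permutes_id)
  have "(\<Prod>t<m. ?c x t) = 0" if x: "x \<in> simplices m p" "x \<noteq> (?S, ?z, id)" for x
  proof (rule ccontr)
    assume "(\<Prod>t<m. ?c x t) \<noteq> 0"
    then have c: "?c x t \<noteq> 0" if "t < m" for t
      using that by (auto simp: prod_zero_iff)
    obtain S a \<rho> where xs: "x = (S, a, \<rho>)" by (cases x) auto
    have "a = ?z" "\<rho> = id"
      using crossing_simplex_unique[OF mono v0 x(1)[unfolded xs] c[unfolded xs]] by auto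
    note xs = xs[unfolded this]
    \<comment> \<open>Crossing in every step is a recurrence that determines the signs, hence
      \<open>S\<close>.\<close>
    have S: "t \<in> S \<longleftrightarrow> 0 < t \<and> blk (t - 1) = blk t \<and> t - 1 \<notin> S" if "t < m" for t
      using c[OF that, unfolded xs straight[OF that]]
      by (simp only: of_bool_eq_0_iff not_not)
    have "t \<notin> S \<longleftrightarrow> alternating blk t" if "t < m" for t
      using that
    proof (induction t)
      case 0
      then show ?case using S[OF 0] by simp
    next
      case (Suc t)
      then show ?case using S[OF Suc.prems] Suc.IH by auto
    qed
    moreover have "S \<subseteq> {..<m}" using x(1) unfolding xs by (auto simp: simplices_def)
    ultimately have "S = ?S" by blast
    then show False using x(2) xs by simp
  qed
  then have "crossings m p (\<lambda>t. model_sign m blk (v t)) = (\<Sum>x\<in>{(?S, ?z, id)}. \<Prod>t<m. ?c x t)"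
    unfolding crossings_def using x0 finite_simplices[of m p] by (intro sum.mono_neutral_right) auto
  also have "\<dots> = 1"
  proof -
    have "?c (?S, ?z, id) t = 1" if "t < m" for t
      unfolding straight[OF that]
      using that by (cases t) auto
    then show ?thesis by simp
  qed
  finally show ?thesis .
qed

text \<open>The count modulo 2 depends only on the parities and is 1 for the model, so some simplex
  contributes.\<close>

theorem discrete_borsuk_ulam:
  assumes "p > 0"
    and "\<And>i j. i \<le> j \<Longrightarrow> j < m \<Longrightarrow> blk i \<le> blk j"
    and "\<And>t l. t < m \<Longrightarrow> l < blk t \<Longrightarrow> v t l = 0"
    and "\<And>t. t < m \<Longrightarrow> v t (blk t) = 1"
    and \<sigma>: "\<And>t. t < m \<Longrightarrow> equivariant m p blk (v t) (\<sigma> t)"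
  shows "\<exists>x\<in>simplices m p. \<forall>t<m. \<sigma> t (vertex m x t) \<noteq> \<sigma> t (vertex m x (Suc t))"
proof -
  have "crossings m p \<sigma> = crossings m p (\<lambda>t. model_sign m blk (v t))"
    by (rule crossings_unique[where blk = blk and v = v])
      (use equivariant_model_sign[OF assms(1)] \<sigma> in auto)
  also have "\<dots> = 1" by (rule crossings_model_sign) (use assms in auto)
  finally have "crossings m p \<sigma> \<noteq> 0" by simp
  then obtain x where x: "x \<in> simplices m p"
    "(\<Prod>t<m. \<sigma> t (vertex m x t) + \<sigma> t (vertex m x (Suc t))) \<noteq> 0"
    unfolding crossings_def by (meson sum.not_neutral_contains_not_neutral)
  then have "\<sigma> t (vertex m x t) \<noteq> \<sigma> t (vertex m x (Suc t))" if "t < m" for t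
    using that bit_add_self(1) by (metis finite_lessThan lessThan_iff prod_zero)
  then show ?thesis using x(1) by blast
qed

subsection \<open>A Borsuk-Ulam theorem for products of spheres\<close>

definition unit_cube :: "(real^'n) set"
  where "unit_cube = {z. \<forall>i. \<bar>z $ i\<bar> \<le> 1}"

text \<open>The counterpart of \<open>negate_block\<close> for vectors; \<open>e\<close> assigns
  coordinates of the space to the indices below \<open>m\<close>.\<close>

definition flip :: "(nat \<Rightarrow> 'n) \<Rightarrow> nat \<Rightarrow> (nat \<Rightarrow> nat) \<Rightarrow> nat \<Rightarrow> real^'n \<Rightarrow> real^'n"
  where "flip e m blk l z = (\<chi> i. if \<exists>c<m. e c = i \<and> blk c = l then - z $ i else z $ i)"

definition grid_point :: "(nat \<Rightarrow> 'n) \<Rightarrow> nat \<Rightarrow> nat \<Rightarrow> (nat \<Rightarrow> int) \<Rightarrow> real^'n"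
  where "grid_point e m p x =
    (\<chi> i. if i \<in> e ` {..<m} then real_of_int (x (inv_into {..<m} e i)) / real p else 0)"

lemma flip_nth:
  assumes "inj_on e {..<m}" "c < m"
  shows "flip e m blk l z $ e c = (if blk c = l then - z $ e c else z $ e c)"
  using inj_on_eq_iff[OF assms(1)] assms(2) by (auto simp: flip_def)

lemma flip_nth_outside: "i \<notin> e ` {..<m} \<Longrightarrow> flip e m blk l z $ i = z $ i"
  by (auto simp: flip_def)

lemma compact_unit_cube: "compact (unit_cube :: (real^'n) set)"
proof -
  have "(unit_cube :: (real^'n) set) = cbox (- 1) 1"
    unfolding unit_cube_def by (auto simp: mem_box_cart abs_le_iff)
  then show ?thesis using compact_cbox by metis
qed

lemma grid_point_nth: "inj_on e {..<m} \<Longrightarrow> c < m \<Longrightarrow> grid_point e m p x $ e c = x c / p"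
  by (simp add: grid_point_def)

lemma grid_point_in_cube:
  assumes p: "p > 0" and x: "x \<in> grid m p"
  shows "grid_point e m p x \<in> unit_cube"
proof -
  have "\<bar>real_of_int (x c) / real p\<bar> \<le> 1" if "c < m" for c
  proof -
    have "\<bar>x c\<bar> \<le> int p" using x that by (auto simp: grid_def)
    then have "\<bar>real_of_int (x c)\<bar> \<le> real p" by linarith
    then show ?thesis using p by (simp add: divide_simps)
  qed
  moreover have "inv_into {..<m} e i < m" if "i \<in> e ` {..<m}" for i
    using inv_into_into[OF that] by simp
  ultimately show ?thesis unfolding unit_cube_def grid_point_def by auto
qed

lemma grid_point_negate_block:
  assumes e: "inj_on e {..<m}"
  shows "grid_point e m p (negate_block blk l x) = flip e m blk l (grid_point e m p x)"
proof -
  have "grid_point e m p (negate_block blk l x) $ i = flip e m blk l (grid_point e m p x) $ i" for i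
  proof (cases "i \<in> e ` {..<m}")
    case True
    then obtain c where "c < m" "i = e c" by auto
    then show ?thesis using e by (simp add: flip_nth grid_point_nth negate_block_def)
  next
    case False
    then show ?thesis by (simp add: flip_nth_outside) (simp add: grid_point_def)
  qed
  then show ?thesis by (simp add: vec_eq_iff)
qed

lemma vertex_diff:
  "\<bar>vertex m x j c - vertex m x j' c\<bar> \<le> 1"
  by (cases x) (auto simp flip: of_nat_Suc)

lemma dist_grid_points:
  fixes e :: "nat \<Rightarrow> 'n::finite"
  assumes p: "p > 0"
  shows "dist (grid_point e m p (vertex m x j)) (grid_point e m p (vertex m x j')) \<le> CARD('n) / p"
proof -
  let ?g = "\<lambda>j. grid_point e m p (vertex m x j)"
  have "\<bar>(?g j - ?g j') $ i\<bar> \<le> 1 / p" for i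
  proof -
    have "\<bar>real_of_int (vertex m x j c) / p - real_of_int (vertex m x j' c) / p\<bar> \<le> 1 / p" for c
    proof -
      have "\<bar>real_of_int (vertex m x j c) - real_of_int (vertex m x j' c)\<bar> \<le> 1"
        using vertex_diff[of m x j c j'] by linarith
      then show ?thesis using p by (simp add: diff_divide_distrib[symmetric] divide_right_mono)
    qed
    then show ?thesis by (simp add: grid_point_def)
  qed
  then have "(\<Sum>i\<in>UNIV. \<bar>(?g j - ?g j') $ i\<bar>) \<le> (\<Sum>i\<in>(UNIV :: 'n set). 1 / p)"
    by (intro sum_mono) auto
  then show ?thesis using norm_le_l1_cart[of "?g j - ?g j'"] by (simp add: dist_norm)
qed

theorem cube_borsuk_ulam:
  fixes e :: "nat \<Rightarrow> 'n::finite" and F :: "nat \<Rightarrow> real^'n \<Rightarrow> real"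
  assumes e: "inj_on e {..<m}"
    and mono: "\<And>i j. i \<le> j \<Longrightarrow> j < m \<Longrightarrow> blk i \<le> blk j"
    and par0: "\<And>t l. t < m \<Longrightarrow> l < blk t \<Longrightarrow> \<not> par t l"
    and par1: "\<And>t. t < m \<Longrightarrow> par t (blk t)"
    and cont: "\<And>t. t < m \<Longrightarrow> continuous_on unit_cube (F t)"
    and flip: "\<And>t z c. t < m \<Longrightarrow> z \<in> unit_cube \<Longrightarrow> c < m \<Longrightarrow> \<bar>z $ e c\<bar> = 1 \<Longrightarrow>
      F t (flip e m blk (blk c) z) = (if par t (blk c) then - F t z else F t z)"
  obtains z where "z \<in> unit_cube" "\<And>t. t < m \<Longrightarrow> F t z = 0"
proof -
  have "\<exists>z\<in>unit_cube. \<forall>t<m. F t z = 0"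
  proof (rule ccontr)
    assume no: "\<not> (\<exists>z\<in>unit_cube. \<forall>t<m. F t z = 0)"
    have zero: "(0 :: real^'n) \<in> unit_cube" by (simp add: unit_cube_def)
    then have m: "m > 0" using no by auto
    let ?G = "\<lambda>z. \<Sum>t<m. \<bar>F t z\<bar>"
    have "continuous_on unit_cube ?G" by (intro continuous_intros cont) auto
    then obtain z0 where z0: "z0 \<in> unit_cube" "\<And>z. z \<in> unit_cube \<Longrightarrow> ?G z0 \<le> ?G z"
      using continuous_attains_inf[OF compact_unit_cube] zero by blast
    \<comment> \<open>Now \<open>?G\<close> is at least \<open>2 * m * \<epsilon>\<close> on the
      cube; the contradiction is a point where every \<open>F t\<close> is below
      \<open>2 * \<epsilon>\<close> in absolute value.\<close>
    define \<epsilon> where "\<epsilon> = ?G z0 / (2 * m)"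
    have "?G z0 \<noteq> 0" using no z0(1) by (subst sum_nonneg_eq_0_iff) auto
    moreover have "?G z0 \<ge> 0" by (intro sum_nonneg) auto
    ultimately have "?G z0 > 0" by linarith
    then have \<epsilon>: "\<epsilon> > 0" unfolding \<epsilon>_def using m by (intro divide_pos_pos) auto
    have "\<exists>\<eta>>0. \<forall>z\<in>unit_cube. \<forall>z'\<in>unit_cube. dist z' z < \<eta> \<longrightarrow> dist (F t z') (F t z) < \<epsilon>"
      if "t < m" for t
      using compact_uniformly_continuous[OF cont[OF that] compact_unit_cube] \<epsilon>
      unfolding uniformly_continuous_on_def by blast
    then obtain \<eta> where \<eta>: "\<And>t. t < m \<Longrightarrow> \<eta> t > 0"
      "\<And>t z z'. t < m \<Longrightarrow> z \<in> unit_cube \<Longrightarrow> z' \<in> unit_cube \<Longrightarrow> dist z' z < \<eta> t \<Longrightarrow>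
        dist (F t z') (F t z) < \<epsilon>"
      by metis
    define \<eta>0 where "\<eta>0 = Min (\<eta> ` {..<m})"
    have \<eta>0: "\<eta>0 > 0" "\<And>t. t < m \<Longrightarrow> \<eta>0 \<le> \<eta> t"
      unfolding \<eta>0_def using m \<eta>(1) by (subst Min_gr_iff) auto
    \<comment> \<open>Vertices of one simplex are at distance at most \<open>CARD('n) / p\<close>,
      which this choice makes smaller than \<open>\<eta>0\<close>.\<close>
    obtain p where p: "real CARD('n) / \<eta>0 < real p" using reals_Archimedean2 by blast
    moreover have "real CARD('n) / \<eta>0 > 0" using \<eta>0 by simp
    ultimately have p0: "p > 0" by (metis of_nat_0_less_iff order_less_trans)
    have mesh: "CARD('n) / p < \<eta>0" using p p0 \<eta>0 by (simp add: field_simps)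
    let ?g = "grid_point e m p"
    let ?v = "\<lambda>t l. of_bool (par t l) :: bit"
    \<comment> \<open>Where \<open>F t\<close> vanishes, the sign is taken from the model, which has
      the same parity; this keeps \<open>\<sigma> t\<close> equivariant at zeros.\<close>
    define \<sigma> where "\<sigma> t x = (if F t (?g x) > 0 then 1 else if F t (?g x) < 0 then 0
      else model_sign m blk (?v t) x)" for t x
    have equi: "equivariant m p blk (?v t) (\<sigma> t)" if t: "t < m" for t
      unfolding equivariant_def
    proof (intro ballI allI impI)
      fix x i assume x: "x \<in> grid m p" and i: "i < m" "\<bar>x i\<bar> = int p"
      have "\<bar>?g x $ e i\<bar> = 1"
      proof -
        have "\<bar>real_of_int (x i)\<bar> = real p" using i(2) by linarith
        then show ?thesis using p0 by (simp add: grid_point_nth[OF e i(1)])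
      qed
      then have "F t (?g (negate_block blk (blk i) x)) = (if par t (blk i) then - F t (?g x) else F t (?g x))"
        unfolding grid_point_negate_block[OF e]
        by (intro flip t grid_point_in_cube p0 x i(1))
      moreover have "model_sign m blk (?v t) (negate_block blk (blk i) x) =
          model_sign m blk (?v t) x + ?v t (blk i)"
        using equivariant_model_sign[OF p0, of m blk "?v t"] x i unfolding equivariant_def by blast
      ultimately show "\<sigma> t (negate_block blk (blk i) x) = \<sigma> t x + ?v t (blk i)"
        unfolding \<sigma>_def by auto
    qed
    have "\<exists>x\<in>simplices m p. \<forall>t<m. \<sigma> t (vertex m x t) \<noteq> \<sigma> t (vertex m x (Suc t))"
      by (rule discrete_borsuk_ulam[where blk = blk and v = ?v]) (simp_all add: p0 mono par0 par1 equi)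
    then obtain x where x: "x \<in> simplices m p"
      "\<And>t. t < m \<Longrightarrow> \<sigma> t (vertex m x t) \<noteq> \<sigma> t (vertex m x (Suc t))" by blast
    let ?w = "\<lambda>j. ?g (vertex m x j)"
    have w: "?w j \<in> unit_cube" for j
      using grid_point_in_cube[OF p0 vertex_in_grid[OF x(1)]] .
    have near: "\<bar>F t (?w j) - F t (?w j')\<bar> < \<epsilon>" if "t < m" for t j j'
    proof -
      have "dist (?w j) (?w j') < \<eta> t"
        using dist_grid_points[OF p0, of e m x j j'] mesh \<eta>0(2)[OF that] by linarith
      then show ?thesis using \<eta>(2)[OF that w w] by (simp add: dist_real_def)
    qed
    have "\<bar>F t (?w 0)\<bar> < 2 * \<epsilon>" if t: "t < m" for t
    proof -
      \<comment> \<open>A weak sign change along edge \<open>t\<close> bounds \<open>F t\<close> by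
        \<open>\<epsilon>\<close> at vertex \<open>t\<close>; passing to vertex 0, common to all
        \<open>t\<close>, costs another \<open>\<epsilon>\<close>.\<close>
      have "F t (?w t) \<le> 0 \<and> F t (?w (Suc t)) \<ge> 0 \<or> F t (?w t) \<ge> 0 \<and> F t (?w (Suc t)) \<le> 0"
        using x(2)[OF t] unfolding \<sigma>_def by (auto split: if_splits)
      then have "\<bar>F t (?w t)\<bar> < \<epsilon>" using near[OF t, of t "Suc t"] by linarith
      then show ?thesis using near[OF t, of 0 t] by linarith
    qed
    then have "?G (?w 0) < (\<Sum>t<m. 2 * \<epsilon>)" by (intro sum_strict_mono) (use m in auto)
    also have "\<dots> = ?G z0" unfolding \<epsilon>_def using m by simp
    finally show False using z0(2)[OF w[of 0]] by simp
  qed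
  then show thesis using that by blast
qed

subsection \<open>Coefficients of homogeneous forms\<close>

definition multi_indices :: "nat \<Rightarrow> nat \<Rightarrow> nat list set"
  where "multi_indices k d = {l. length l = k \<and> sum_list l = d}"

definition monomial :: "nat \<Rightarrow> nat list \<Rightarrow> (nat \<Rightarrow> real) \<Rightarrow> real"
  where "monomial k l y = (\<Prod>i<k. y i ^ (l ! i))"

definition homogeneous_forms :: "nat \<Rightarrow> nat \<Rightarrow> ((nat \<Rightarrow> real) \<Rightarrow> real) set"
  where "homogeneous_forms k d = {q. \<exists>C. q = (\<lambda>y. \<Sum>l\<in>multi_indices k d. C l * monomial k l y)}"

lemma multi_index_le:
  assumes "l \<in> multi_indices k d" "i < k"
  shows "l ! i \<le> d"
  using assms elem_le_sum_list[of i l] by (auto simp: multi_indices_def)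

lemma finite_multi_indices: "finite (multi_indices k d)"
proof (rule finite_subset)
  show "multi_indices k d \<subseteq> {l. set l \<subseteq> {..d} \<and> length l = k}"
    using multi_index_le by (fastforce simp: multi_indices_def in_set_conv_nth)
qed (rule finite_lists_length_eq, simp)

lemma card_multi_indices: "card (multi_indices k d) = (d + k - 1) choose d"
  unfolding multi_indices_def by (rule card_length_sum_list)

lemma homogeneous_formsI:
  "(\<And>y. q y = (\<Sum>l\<in>multi_indices k d. C l * monomial k l y)) \<Longrightarrow> q \<in> homogeneous_forms k d"
  unfolding homogeneous_forms_def by (intro CollectI exI[of _ C] ext)

lemma homogeneous_forms_0: "(\<lambda>y. 0) \<in> homogeneous_forms k d"
  by (rule homogeneous_formsI[where C = "\<lambda>_. 0"]) simp

lemma homogeneous_forms_add: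
  assumes "q \<in> homogeneous_forms k d" "r \<in> homogeneous_forms k d"
  shows "(\<lambda>y. q y + r y) \<in> homogeneous_forms k d"
proof -
  obtain C D where "q = (\<lambda>y. \<Sum>l\<in>multi_indices k d. C l * monomial k l y)"
    "r = (\<lambda>y. \<Sum>l\<in>multi_indices k d. D l * monomial k l y)"
    using assms unfolding homogeneous_forms_def by auto
  then have "q y + r y = (\<Sum>l\<in>multi_indices k d. (C l + D l) * monomial k l y)" for y
    by (simp add: sum.distrib distrib_right)
  then show ?thesis by (rule homogeneous_formsI)
qed

lemma homogeneous_forms_scale:
  assumes "q \<in> homogeneous_forms k d"
  shows "(\<lambda>y. c * q y) \<in> homogeneous_forms k d"
proof -
  obtain C where "q = (\<lambda>y. \<Sum>l\<in>multi_indices k d. C l * monomial k l y)"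
    using assms unfolding homogeneous_forms_def by auto
  then have "c * q y = (\<Sum>l\<in>multi_indices k d. (c * C l) * monomial k l y)" for y
    by (simp add: sum_distrib_left mult.assoc)
  then show ?thesis by (rule homogeneous_formsI)
qed

lemma homogeneous_forms_sum:
  "(\<And>j. j \<in> A \<Longrightarrow> q j \<in> homogeneous_forms k d) \<Longrightarrow> (\<lambda>y. \<Sum>j\<in>A. q j y) \<in> homogeneous_forms k d"
proof (induction A rule: infinite_finite_induct)
  case (insert j A)
  then show ?case using homogeneous_forms_add[of "q j" k d "\<lambda>y. \<Sum>j\<in>A. q j y"] by simp
qed (simp_all add: homogeneous_forms_0)

lemma monomial_in_homogeneous_forms:
  assumes "l \<in> multi_indices k d"
  shows "monomial k l \<in> homogeneous_forms k d"
proof -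
  have "monomial k l y = (\<Sum>l'\<in>multi_indices k d. (if l' = l then 1 else 0) * monomial k l' y)" for y
    using assms finite_multi_indices[of k d] by (simp add: if_distrib[of "\<lambda>c. c * _"] cong: if_cong)
  then show ?thesis by (rule homogeneous_formsI)
qed

lemma homogeneous_forms_mult_var:
  assumes q: "q \<in> homogeneous_forms k d" and i: "i < k"
  shows "(\<lambda>y. q y * y i) \<in> homogeneous_forms k (Suc d)"
proof -
  obtain C where C: "q = (\<lambda>y. \<Sum>l\<in>multi_indices k d. C l * monomial k l y)"
    using q unfolding homogeneous_forms_def by auto
  have "(\<lambda>y. C l * monomial k l y * y i) \<in> homogeneous_forms k (Suc d)" if l: "l \<in> multi_indices k d" for l
  proof -
    let ?l = "l[i := Suc (l ! i)]"
    have "?l \<in> multi_indices k (Suc d)"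
      using l i elem_le_sum_list[of i l] by (simp add: multi_indices_def sum_list_update)
    moreover have "monomial k ?l y = monomial k l y * y i" for y
    proof -
      have "monomial k ?l y = (\<Prod>j<k. y j ^ (l ! j) * (if j = i then y i else 1))"
        unfolding monomial_def using l i by (intro prod.cong) (auto simp: multi_indices_def nth_list_update)
      then show ?thesis using i by (simp add: prod.distrib monomial_def)
    qed
    ultimately show ?thesis
      using homogeneous_forms_scale[OF monomial_in_homogeneous_forms[of ?l k "Suc d"], of "C l"]
      by (simp add: mult.assoc)
  qed
  then have "(\<lambda>y. \<Sum>l\<in>multi_indices k d. C l * monomial k l y * y i) \<in> homogeneous_forms k (Suc d)"
    by (rule homogeneous_forms_sum)
  then show ?thesis unfolding C by (simp add: sum_distrib_right)
qed

lemma prod_linear_forms: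
  "(\<lambda>y. \<Prod>r<d. \<Sum>i<k. a r i * y i) \<in> homogeneous_forms k d"
proof (induction d)
  case 0
  have "replicate k 0 \<in> multi_indices k 0" by (simp add: multi_indices_def sum_list_replicate)
  from monomial_in_homogeneous_forms[OF this] show ?case by (simp add: monomial_def[abs_def])
next
  case (Suc d)
  let ?P = "\<lambda>y. \<Prod>r<d. \<Sum>i<k. a r i * y i"
  have "(\<lambda>y. \<Sum>i<k. a d i * (?P y * y i)) \<in> homogeneous_forms k (Suc d)"
    by (intro homogeneous_forms_sum homogeneous_forms_scale homogeneous_forms_mult_var Suc) simp
  then show ?case by (simp add: sum_distrib_left mult.left_commute)
qed

text \<open>Each factor \<open>a j i \<bullet> x\<close> becomes a linear form in \<open>y\<close>.
  The family \<open>b\<close> is arbitrary, so this serves both frames and the standard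
  basis.\<close>

lemma symmetric_power_coordinates:
  assumes "p \<in> symmetric_power d V"
  shows "(\<lambda>y. p (\<Sum>i<k. y i *\<^sub>R b i)) \<in> homogeneous_forms k d"
proof -
  obtain N c a where p: "p = (\<lambda>x. \<Sum>j<(N::nat). c j * (\<Prod>i<d. a j i \<bullet> x))"
    by (rule symmetric_powerE[OF assms])
  have "(\<lambda>y. \<Sum>j<N. c j * (\<Prod>r<d. \<Sum>i<k. (a j r \<bullet> b i) * y i)) \<in> homogeneous_forms k d"
    by (intro homogeneous_forms_sum homogeneous_forms_scale prod_linear_forms)
  then show ?thesis unfolding p by (simp add: inner_sum_right mult.commute)
qed

section \<open>Interpolation weights that extract coefficients\<close>

lemma vandermonde_solvable:
  fixes r :: "nat \<Rightarrow> real"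
  shows "\<exists>\<kappa>. \<forall>b\<le>d. (\<Sum>j\<le>d. \<kappa> j * real j ^ b) = r b"
proof (induction d arbitrary: r)
  case 0
  show ?case by (intro exI[of _ "\<lambda>_. r 0"]) simp
next
  case (Suc d)
  let ?x = "real (Suc d)"
  obtain \<mu> where \<mu>: "\<And>b. b \<le> d \<Longrightarrow> (\<Sum>j\<le>d. \<mu> j * real j ^ b) = r (Suc b) - ?x * r b"
    using Suc.IH[of "\<lambda>b. r (Suc b) - ?x * r b"] by blast
  \<comment> \<open>The factor \<open>real j - ?x\<close> removes the node \<open>?x\<close>, so the
    weights at the other nodes come from \<open>\<mu>\<close>; the weight at \<open>?x\<close> is
    then fixed by the moment of order 0.\<close>
  define \<kappa> where "\<kappa> j = (if j \<le> d then \<mu> j / (real j - ?x)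
    else r 0 - (\<Sum>j\<le>d. \<mu> j / (real j - ?x)))" for j
  have "(\<Sum>j\<le>Suc d. \<kappa> j * real j ^ b) = r b" if "b \<le> Suc d" for b
    using that
  proof (induction b)
    case 0
    then show ?case by (simp add: \<kappa>_def)
  next
    case (Suc b)
    have "(\<Sum>j\<le>Suc d. \<kappa> j * real j ^ Suc b) - ?x * (\<Sum>j\<le>Suc d. \<kappa> j * real j ^ b) =
      (\<Sum>j\<le>Suc d. \<kappa> j * (real j - ?x) * real j ^ b)"
      unfolding sum_distrib_left sum_subtractf[symmetric] by (intro sum.cong) (auto simp: algebra_simps)
    also have "\<dots> = (\<Sum>j\<le>d. \<mu> j * real j ^ b)"
      unfolding sum.atMost_Suc by (auto simp: \<kappa>_def intro!: sum.cong)
    also have "\<dots> = r (Suc b) - ?x * r b" using \<mu> Suc.prems by simp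
    finally show ?case using Suc by simp
  qed
  then show ?case by blast
qed

definition power_dual :: "nat \<Rightarrow> nat \<Rightarrow> nat \<Rightarrow> real"
  where "power_dual d a = (SOME \<kappa>. \<forall>b\<le>d. (\<Sum>j\<le>d. \<kappa> j * real j ^ b) = of_bool (b = a))"

lemma power_dual: "b \<le> d \<Longrightarrow> (\<Sum>j\<le>d. power_dual d a j * real j ^ b) = of_bool (b = a)"
  unfolding power_dual_def using someI_ex[OF vandermonde_solvable[of d "\<lambda>b. of_bool (b = a)"]] by blast

text \<open>The coefficient of a monomial, as a linear combination of values at integer points: it is
  continuous for pointwise convergence.\<close>

definition form_coeff :: "nat \<Rightarrow> nat \<Rightarrow> nat list \<Rightarrow> ((nat \<Rightarrow> real) \<Rightarrow> real) \<Rightarrow> real"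
  where "form_coeff k d l q = (\<Sum>w\<in>PiE {..<k} (\<lambda>_. {..d}).
    (\<Prod>i<k. power_dual d (l ! i) (w i)) * q (\<lambda>i. real (w i)))"

text \<open>The sum over the grid factors into one sum per variable, each of which tests equality of
  two exponents.\<close>

lemma form_coeff_monomial:
  assumes "l \<in> multi_indices k d" "l' \<in> multi_indices k d"
  shows "form_coeff k d l (monomial k l') = of_bool (l' = l)"
proof -
  have "form_coeff k d l (monomial k l') =
    (\<Sum>w\<in>PiE {..<k} (\<lambda>_. {..d}). \<Prod>i<k. power_dual d (l ! i) (w i) * real (w i) ^ (l' ! i))"
    unfolding form_coeff_def monomial_def by (simp add: prod.distrib)
  also have "\<dots> = (\<Prod>i<k. \<Sum>j\<le>d. power_dual d (l ! i) j * real j ^ (l' ! i))"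
    by (rule prod_sum_PiE[symmetric]) auto
  also have "\<dots> = (\<Prod>i<k. of_bool (l' ! i = l ! i))"
    by (intro prod.cong refl power_dual multi_index_le[OF assms(2)]) simp
  also have "\<dots> = of_bool (\<forall>i<k. l' ! i = l ! i)" by (induction k) (auto simp: less_Suc_eq)
  also have "(\<forall>i<k. l' ! i = l ! i) \<longleftrightarrow> l' = l"
    using assms by (auto simp: multi_indices_def list_eq_iff_nth_eq)
  finally show ?thesis .
qed

lemma form_coeff_sum:
  assumes l: "l \<in> multi_indices k d"
  shows "form_coeff k d l (\<lambda>y. \<Sum>l'\<in>multi_indices k d. C l' * monomial k l' y) = C l"
proof -
  have "form_coeff k d l (\<lambda>y. \<Sum>l'\<in>multi_indices k d. C l' * monomial k l' y) =
    (\<Sum>w\<in>PiE {..<k} (\<lambda>_. {..d}). \<Sum>l'\<in>multi_indices k d.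
      C l' * ((\<Prod>i<k. power_dual d (l ! i) (w i)) * monomial k l' (\<lambda>i. real (w i))))"
    unfolding form_coeff_def by (simp add: sum_distrib_left mult_ac)
  also have "\<dots> = (\<Sum>l'\<in>multi_indices k d. C l' * form_coeff k d l (monomial k l'))"
    unfolding form_coeff_def by (subst sum.swap) (simp add: sum_distrib_left)
  also have "\<dots> = (\<Sum>l'\<in>multi_indices k d. C l' * of_bool (l' = l))"
    using form_coeff_monomial[OF l] by (intro sum.cong) auto
  also have "\<dots> = C l" using l finite_multi_indices[of k d]
    by (simp add: of_bool_def if_distrib cong: if_cong)
  finally show ?thesis .
qed

lemma homogeneous_form_expansion:
  assumes "q \<in> homogeneous_forms k d"
  shows "q y = (\<Sum>l\<in>multi_indices k d. form_coeff k d l q * monomial k l y)"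
proof -
  obtain C where C: "q = (\<lambda>y. \<Sum>l\<in>multi_indices k d. C l * monomial k l y)"
    using assms unfolding homogeneous_forms_def by auto
  then have "form_coeff k d l q = C l" if "l \<in> multi_indices k d" for l
    using form_coeff_sum[OF that] by simp
  then show ?thesis unfolding C by (auto intro: sum.cong)
qed

text \<open>The source of the parities: reversing coordinate \<open>i\<close> multiplies each
  monomial by a sign given by its \<open>i\<close>-th exponent.\<close>

lemma form_coeff_reflect:
  assumes q: "q \<in> homogeneous_forms k d" and l: "l \<in> multi_indices k d" and i: "i < k"
  shows "form_coeff k d l (\<lambda>y. q (y(i := - y i))) = (- 1) ^ (l ! i) * form_coeff k d l q"
proof -
  have "monomial k l' (y(i := - y i)) = (- 1) ^ (l' ! i) * monomial k l' y" for l' y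
  proof -
    have "monomial k l' (y(i := - y i)) = (\<Prod>j<k. (if j = i then (- 1) ^ (l' ! i) else 1) * y j ^ (l' ! j))"
      unfolding monomial_def by (intro prod.cong) (auto simp: power_minus[of "y i"])
    then show ?thesis using i by (simp add: prod.distrib monomial_def)
  qed
  then have "(\<lambda>y. q (y(i := - y i))) =
    (\<lambda>y. \<Sum>l'\<in>multi_indices k d. ((- 1) ^ (l' ! i) * form_coeff k d l' q) * monomial k l' y)"
    using homogeneous_form_expansion[OF q] by (simp add: mult_ac)
  then show ?thesis using form_coeff_sum[OF l, of "\<lambda>l'. (- 1) ^ (l' ! i) * form_coeff k d l' q"] by simp
qed

subsection \<open>Sections of the symmetric power\<close>

lemma section_in_symmetric_power:
  assumes "bundle_section d k s" "V \<in> k_subspaces k"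
  shows "snd (s V) \<in> symmetric_power d V" "s V = (V, snd (s V))"
proof -
  have "s V \<in> topspace (symmetric_power_bundle d k)"
    using assms continuous_map_image_subset_topspace unfolding bundle_section_def by fastforce
  then have "s V \<in> (SIGMA V : k_subspaces k. symmetric_power d V)"
    by (simp add: symmetric_power_bundle_def)
  moreover have "fst (s V) = V" using assms by (simp add: bundle_section_def)
  ultimately show "snd (s V) \<in> symmetric_power d V" "s V = (V, snd (s V))"
    by (cases "s V"; simp)+
qed

lemma continuous_section_value:
  assumes "bundle_section d k s"
  shows "continuous_map (frames k) euclideanreal (\<lambda>f. snd (s (span (f ` {..<k}))) w)"
proof -
  have "continuous_map (grassmannian k) (prod_topology (grassmannian k) (powertop_real UNIV)) s"
    using assms unfolding bundle_section_def symmetric_power_bundle_def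
    by (blast intro: continuous_map_into_fulltopology)
  then have "continuous_map (grassmannian k) (powertop_real UNIV) (snd \<circ> s)"
    by (rule continuous_map_compose) (rule continuous_map_snd)
  then have "continuous_map (frames k) (powertop_real UNIV) ((snd \<circ> s) \<circ> (\<lambda>f. span (f ` {..<k})))"
    by (rule continuous_map_compose[OF quotient_imp_continuous_map[OF quotient_map_span]])
  then show ?thesis
    by (simp add: continuous_map_componentwise_UNIV comp_def)
qed

section \<open>The section in the coordinates of a frame\<close>

definition frame_form ::
    "((real^'n) set \<Rightarrow> (real^'n) set \<times> (real^'n \<Rightarrow> real)) \<Rightarrow> nat \<Rightarrow> (nat \<Rightarrow> real^'n) \<Rightarrow> (nat \<Rightarrow> real) \<Rightarrow> real"
  where "frame_form s k b y = snd (s (span (b ` {..<k}))) (\<Sum>i<k. y i *\<^sub>R b i)"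

lemma span_image_frame:
  fixes b :: "nat \<Rightarrow> real^'n"
  assumes "inj_on b {..<k}" "independent (b ` {..<k})"
  shows "restrict b {..<k} \<in> topspace (frames k)" "span (b ` {..<k}) \<in> k_subspaces k"
proof -
  have eq: "restrict b {..<k} ` {..<k} = b ` {..<k}" by auto
  show *: "restrict b {..<k} \<in> topspace (frames k)"
    unfolding topspace_frames eq using assms by (auto simp: inj_on_def)
  show "span (b ` {..<k}) \<in> k_subspaces k" using span_frame[OF *] unfolding eq .
qed

lemma continuous_on_section_value:
  fixes b :: "'a::topological_space \<Rightarrow> nat \<Rightarrow> real^'n"
  assumes s: "bundle_section d k s"
    and b: "\<And>i. i < k \<Longrightarrow> continuous_on S (\<lambda>z. b z i)"
    and frame: "\<And>z. z \<in> S \<Longrightarrow> inj_on (b z) {..<k}" "\<And>z. z \<in> S \<Longrightarrow> independent (b z ` {..<k})"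
  shows "continuous_on S (\<lambda>z. snd (s (span (b z ` {..<k}))) w)"
proof -
  have "continuous_map (top_of_set S) (frames k) (\<lambda>z. restrict (b z) {..<k})"
    unfolding frames_def
  proof (intro continuous_map_into_subtopology)
    show "continuous_map (top_of_set S) (product_topology (\<lambda>_. euclidean) {..<k}) (\<lambda>z. restrict (b z) {..<k})"
      unfolding continuous_map_componentwise using b by auto
    show "(\<lambda>z. restrict (b z) {..<k}) \<in> topspace (top_of_set S) \<rightarrow>
        {f. inj_on f {..<k} \<and> independent (f ` {..<k})}"
      using span_image_frame(1)[OF frame] by (auto simp: topspace_frames)
  qed
  from continuous_map_compose[OF this continuous_section_value[OF s]]
  have "continuous_map (top_of_set S) euclideanreal
      (\<lambda>z. snd (s (span (restrict (b z) {..<k} ` {..<k}))) w)" by (simp only: comp_def)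
  moreover have "restrict (b z) {..<k} ` {..<k} = b z ` {..<k}" for z by auto
  ultimately show ?thesis by simp
qed

text \<open>Pointwise convergence controls values at fixed points only. In standard coordinates the
  value at \<open>v z\<close> is a sum of coefficients, which are combinations of values at fixed
  points, times monomials in the coordinates of \<open>v z\<close>.\<close>

lemma continuous_on_section_moving:
  fixes b :: "'a::topological_space \<Rightarrow> nat \<Rightarrow> real^'n"
  assumes s: "bundle_section d k s"
    and b: "\<And>i. i < k \<Longrightarrow> continuous_on S (\<lambda>z. b z i)"
    and frame: "\<And>z. z \<in> S \<Longrightarrow> inj_on (b z) {..<k}" "\<And>z. z \<in> S \<Longrightarrow> independent (b z ` {..<k})"
    and v: "continuous_on S v"
  shows "continuous_on S (\<lambda>z. snd (s (span (b z ` {..<k}))) (v z))"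
proof -
  let ?n = "CARD('n)"
  let ?p = "\<lambda>z. snd (s (span (b z ` {..<k})))"
  obtain u :: "nat \<Rightarrow> 'n" where u: "bij_betw u {..<?n} UNIV"
    using ex_bij_betw_nat_finite[of "UNIV :: 'n set"] by (auto simp: atLeast0LessThan)
  let ?x = "\<lambda>y. \<Sum>i<?n. y i *\<^sub>R axis (u i) (1 :: real)"
  have x: "?x (\<lambda>i. w $ u i) = w" for w :: "real^'n"
  proof -
    have "?x (\<lambda>i. w $ u i) = (\<Sum>j\<in>UNIV. w $ j *\<^sub>R axis j 1)"
      by (rule sum.reindex_bij_betw[OF u])
    then show ?thesis using basis_expansion[of w] by (simp add: scalar_mult_eq_scaleR)
  qed
  have "?p z (v z) = (\<Sum>l\<in>multi_indices ?n d.
      form_coeff ?n d l (\<lambda>y. ?p z (?x y)) * monomial ?n l (\<lambda>i. v z $ u i))" if "z \<in> S" for z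
  proof -
    have "?p z \<in> symmetric_power d (span (b z ` {..<k}))"
      by (rule section_in_symmetric_power(1)[OF s span_image_frame(2)[OF frame[OF that]]])
    from homogeneous_form_expansion[OF symmetric_power_coordinates[OF this,
          where k = ?n and b = "\<lambda>i. axis (u i) 1"], of "\<lambda>i. v z $ u i"]
    show ?thesis unfolding x .
  qed
  moreover have "continuous_on S (\<lambda>z. \<Sum>l\<in>multi_indices ?n d.
      form_coeff ?n d l (\<lambda>y. ?p z (?x y)) * monomial ?n l (\<lambda>i. v z $ u i))"
    unfolding form_coeff_def monomial_def
    by (intro continuous_intros continuous_on_section_value[OF s b frame] v)
  ultimately show ?thesis by (simp cong: continuous_on_cong)
qed

section \<open>Orthogonal frames parametrized by the cube\<close>

text \<open>Parametrizes the \<open>i\<close>-th sphere, up to scaling, by the coordinates of block \<open>i\<close>: the last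
  coefficient vanishes exactly on the boundary of the cube, where antipodal points therefore
  give opposite vectors.\<close>

definition block_frame :: "(nat \<Rightarrow> 'n) \<Rightarrow> nat \<Rightarrow> (nat \<Rightarrow> nat) \<Rightarrow> real^'n \<Rightarrow> nat \<Rightarrow> real^'n"
  where "block_frame e m blk z i =
    (\<Sum>c\<in>{c\<in>{..<m}. blk c = i}. z $ e c *\<^sub>R axis (e c) 1) +
    (\<Prod>c\<in>{c\<in>{..<m}. blk c = i}. 1 - (z $ e c)\<^sup>2) *\<^sub>R axis (e (m + i)) 1"

lemma continuous_on_block_frame: "continuous_on S (\<lambda>z. block_frame e m blk z i)"
  unfolding block_frame_def by (intro continuous_intros)

context
  fixes e :: "nat \<Rightarrow> 'n::finite" and m k :: nat and blk :: "nat \<Rightarrow> nat"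
  assumes e: "inj_on e {..<m + k}" and blk: "\<And>c. c < m \<Longrightarrow> blk c < k"
begin

lemma index_eq_iff: "c < m + k \<Longrightarrow> c' < m + k \<Longrightarrow> e c = e c' \<longleftrightarrow> c = c'"
  using inj_on_eq_iff[OF e] by simp

lemma block_frame_nth:
  assumes "c < m" "i < k"
  shows "block_frame e m blk z i $ e c = (if blk c = i then z $ e c else 0)"
proof -
  have "(\<Sum>c'\<in>{c'\<in>{..<m}. blk c' = i}. z $ e c' *\<^sub>R axis (e c') 1) $ e c =
      (\<Sum>c'\<in>{c'\<in>{..<m}. blk c' = i}. if c' = c then z $ e c else 0)"
    unfolding sum_component by (rule sum.cong) (use assms in \<open>auto simp: axis_def index_eq_iff\<close>)
  then show ?thesis unfolding block_frame_def using assms by (simp add: axis_def index_eq_iff)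
qed

lemma block_frame_nth_last:
  assumes "j < k" "i < k"
  shows "block_frame e m blk z i $ e (m + j) =
    (if i = j then \<Prod>c\<in>{c\<in>{..<m}. blk c = i}. 1 - (z $ e c)\<^sup>2 else 0)"
proof -
  have "(\<Sum>c\<in>{c\<in>{..<m}. blk c = i}. z $ e c *\<^sub>R axis (e c) 1) $ e (m + j) = 0"
    using assms by (auto simp: axis_def index_eq_iff intro!: sum.neutral)
  then show ?thesis unfolding block_frame_def using assms by (simp add: axis_def index_eq_iff)
qed

lemma block_frame_nth_outside:
  assumes "j \<notin> e ` {..<m + k}" "i < k"
  shows "block_frame e m blk z i $ j = 0"
proof -
  have "j \<noteq> e c" if "c < m + k" for c using assms that by auto
  then show ?thesis unfolding block_frame_def using assms(2)
    by (auto simp: axis_def intro!: sum.neutral)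
qed

text \<open>If the last coefficient vanishes, some coordinate of the block is 1 or -1.\<close>

lemma block_frame_nonzero:
  assumes "i < k"
  shows "block_frame e m blk z i \<noteq> 0"
proof
  assume 0: "block_frame e m blk z i = 0"
  then have "(\<Prod>c\<in>{c\<in>{..<m}. blk c = i}. 1 - (z $ e c)\<^sup>2) = 0"
    using block_frame_nth_last[OF assms assms, of z] by simp
  then obtain c where "c < m" "blk c = i" "1 - (z $ e c)\<^sup>2 = 0" by auto
  then show False using block_frame_nth[of c i z] 0 assms by simp
qed

text \<open>The two vectors have disjoint supports.\<close>

lemma block_frame_orthogonal:
  assumes "i < k" "i' < k" "i \<noteq> i'"
  shows "block_frame e m blk z i \<bullet> block_frame e m blk z i' = 0"
proof -
  have "block_frame e m blk z i $ j = 0 \<or> block_frame e m blk z i' $ j = 0" for j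
  proof (cases "j \<in> e ` {..<m + k}")
    case True
    then obtain c where c: "c < m + k" "j = e c" by auto
    show ?thesis
    proof (cases "c < m")
      case True
      then show ?thesis using c assms by (simp add: block_frame_nth)
    next
      case False
      then obtain l where "c = m + l" "l < k" using c by (metis le_Suc_ex nat_add_left_cancel_less not_less)
      then show ?thesis using c assms by (simp add: block_frame_nth_last)
    qed
  qed (use assms in \<open>simp add: block_frame_nth_outside\<close>)
  then show ?thesis unfolding inner_vec_def by (intro sum.neutral) auto
qed

lemma block_frame_independent:
  "inj_on (block_frame e m blk z) {..<k}" "independent (block_frame e m blk z ` {..<k})"
proof -
  show "inj_on (block_frame e m blk z) {..<k}"
    by (rule inj_onI) (metis block_frame_nonzero block_frame_orthogonal inner_eq_zero_iff lessThan_iff)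
  show "independent (block_frame e m blk z ` {..<k})"
  proof (rule pairwise_orthogonal_independent)
    show "pairwise orthogonal (block_frame e m blk z ` {..<k})"
      unfolding pairwise_def orthogonal_def using block_frame_orthogonal by auto
    show "0 \<notin> block_frame e m blk z ` {..<k}" using block_frame_nonzero by force
  qed
qed

text \<open>On the boundary of the block the last coefficient vanishes, and the rest is linear in
  the coordinates of the block.\<close>

lemma block_frame_flip:
  assumes c: "c < m" "\<bar>z $ e c\<bar> = 1" and i: "i < k"
  shows "block_frame e m blk (flip e m blk (blk c) z) i =
    (if i = blk c then - block_frame e m blk z i else block_frame e m blk z i)"
proof -
  let ?z = "flip e m blk (blk c) z"
  let ?B = "{c\<in>{..<m}. blk c = i}"
  have em: "inj_on e {..<m}" using e by (rule inj_on_subset) auto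
  have prod: "(\<Prod>c\<in>?B. 1 - (?z $ e c)\<^sup>2) = (\<Prod>c\<in>?B. 1 - (z $ e c)\<^sup>2)"
    by (intro prod.cong) (auto simp: flip_nth[OF em])
  show ?thesis
  proof (cases "i = blk c")
    case True
    have "1 - (z $ e c)\<^sup>2 = 0" using c(2) by (metis power2_abs one_power2 diff_self)
    then have "(\<Prod>c\<in>?B. 1 - (z $ e c)\<^sup>2) = 0" using c(1) True by (intro prod_zero) auto
    moreover have "(\<Sum>c\<in>?B. ?z $ e c *\<^sub>R axis (e c) (1 :: real)) = - (\<Sum>c\<in>?B. z $ e c *\<^sub>R axis (e c) 1)"
      unfolding sum_negf[symmetric] by (intro sum.cong) (auto simp: flip_nth[OF em] True)
    ultimately show ?thesis unfolding block_frame_def prod using True by simp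
  next
    case False
    have "(\<Sum>c\<in>?B. ?z $ e c *\<^sub>R axis (e c) (1 :: real)) = (\<Sum>c\<in>?B. z $ e c *\<^sub>R axis (e c) 1)"
      by (intro sum.cong) (use False in \<open>auto simp: flip_nth[OF em]\<close>)
    then show ?thesis unfolding block_frame_def prod using False by simp
  qed
qed

text \<open>Reversing one frame vector keeps the span, hence the polynomial, and reverses one
  coordinate.\<close>

lemma frame_form_flip:
  assumes c: "c < m" "\<bar>z $ e c\<bar> = 1"
  shows "frame_form s k (block_frame e m blk (flip e m blk (blk c) z)) y =
    frame_form s k (block_frame e m blk z) (y(blk c := - y (blk c)))"
proof -
  let ?b = "block_frame e m blk z" and ?b' = "block_frame e m blk (flip e m blk (blk c) z)"
  have b': "?b' i = (if i = blk c then - ?b i else ?b i)" if "i < k" for i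
    using block_frame_flip[OF c that] .
  have neg: "?b i \<in> span (?b ` {..<k})" "- ?b i \<in> span (?b ` {..<k})" if "i < k" for i
    using that by (simp_all add: span_base span_neg)
  have "?b i \<in> span (?b' ` {..<k})" if "i < k" for i
  proof -
    have "?b' i \<in> span (?b' ` {..<k})" using that by (auto intro!: span_base)
    then show ?thesis using b'[OF that] span_neg[of "?b' i"] by (auto split: if_splits)
  qed
  then have "span (?b' ` {..<k}) = span (?b ` {..<k})"
    using neg b' by (intro span_eq[THEN iffD2] conjI) (auto split: if_splits)
  moreover have "(\<Sum>i<k. y i *\<^sub>R ?b' i) = (\<Sum>i<k. (y(blk c := - y (blk c))) i *\<^sub>R ?b i)"
    by (intro sum.cong) (auto simp: b')
  ultimately show ?thesis unfolding frame_form_def by simp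
qed

end

section \<open>Assembling the zero of a section\<close>

lemma span_image_eq_sums:
  fixes b :: "nat \<Rightarrow> 'a::real_vector"
  assumes "v \<in> span (b ` {..<k})"
  obtains y where "v = (\<Sum>i<k. y i *\<^sub>R b i)"
proof -
  let ?W = "range (\<lambda>y. \<Sum>i<k. y i *\<^sub>R b i)"
  have "subspace ?W"
    unfolding subspace_def
  proof (intro conjI ballI allI)
    show "0 \<in> ?W" by (rule range_eqI[of _ _ "\<lambda>_. 0"]) simp
  next
    fix x x' assume "x \<in> ?W" "x' \<in> ?W"
    then obtain y y' where "x = (\<Sum>i<k. y i *\<^sub>R b i)" "x' = (\<Sum>i<k. y' i *\<^sub>R b i)" by auto
    then show "x + x' \<in> ?W"
      by (intro range_eqI[of _ _ "\<lambda>i. y i + y' i"]) (simp add: scaleR_add_left sum.distrib)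
  next
    fix c :: real and x assume "x \<in> ?W"
    then obtain y where "x = (\<Sum>i<k. y i *\<^sub>R b i)" by auto
    then show "c *\<^sub>R x \<in> ?W"
      by (intro range_eqI[of _ _ "\<lambda>i. c * y i"]) (simp add: scaleR_sum_right)
  qed
  moreover have "b i \<in> ?W" if "i < k" for i
  proof (rule range_eqI)
    have "(\<Sum>j<k. (if j = i then 1 else 0) *\<^sub>R b j) = (\<Sum>j<k. if j = i then b j else 0)"
      by (intro sum.cong) auto
    then show "b i = (\<Sum>j<k. (if j = i then 1 else 0) *\<^sub>R b j)" using that by simp
  qed
  ultimately have "span (b ` {..<k}) \<subseteq> ?W" by (intro span_minimal) auto
  then show thesis using assms that by blast
qed

text \<open>Sorting the exponent lists by their first odd position makes \<open>blk\<close>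
  monotone; such a position exists below \<open>k\<close> because the exponents have an odd
  sum.\<close>

lemma enumerate_multi_indices:
  assumes "odd d"
  obtains al blk where "bij_betw al {..<(d + k - 1) choose d} (multi_indices k d)"
    "\<And>i j. i \<le> j \<Longrightarrow> j < (d + k - 1) choose d \<Longrightarrow> blk i \<le> blk j"
    "\<And>t. t < (d + k - 1) choose d \<Longrightarrow> blk t < k \<and> odd (al t ! blk t) \<and> (\<forall>l<blk t. even (al t ! l))"
proof -
  let ?m = "(d + k - 1) choose d"
  define B where "B l = (LEAST i. odd (l ! i))" for l :: "nat list"
  obtain ys where ys: "set ys = multi_indices k d" "distinct ys"
    using finite_distinct_list[OF finite_multi_indices] by blast
  define xs where "xs = sort_key B ys"
  have xs: "set xs = multi_indices k d" "distinct xs" "sorted (map B xs)"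
    unfolding xs_def using ys by auto
  have len: "length xs = ?m" using distinct_card[OF xs(2)] xs(1) card_multi_indices[of k d] by simp
  show thesis
  proof (rule that[of "\<lambda>t. xs ! t" "\<lambda>t. if t < ?m then B (xs ! t) else 0"])
    show "bij_betw ((!) xs) {..<?m} (multi_indices k d)"
      using bij_betw_nth[OF xs(2) _ xs(1)[symmetric]] len by simp
  next
    fix i j assume "i \<le> j" "j < ?m"
    then show "(if i < ?m then B (xs ! i) else 0) \<le> (if j < ?m then B (xs ! j) else 0)"
      using sorted_nth_mono[OF xs(3), of i j] len by simp
  next
    fix t assume t: "t < ?m"
    then have "xs ! t \<in> multi_indices k d" using xs(1) len by (metis nth_mem)
    then have l: "length (xs ! t) = k" "sum_list (xs ! t) = d" by (auto simp: multi_indices_def)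
    have "\<exists>i<k. odd (xs ! t ! i)"
    proof (rule ccontr)
      assume "\<not> (\<exists>i<k. odd (xs ! t ! i))"
      then have "even (\<Sum>i<k. xs ! t ! i)" by (intro dvd_sum) auto
      then show False using \<open>odd d\<close> l by (simp add: sum_list_sum_nth atLeast0LessThan)
    qed
    then obtain i where i: "i < k" "odd (xs ! t ! i)" by blast
    have "odd (xs ! t ! B (xs ! t))" unfolding B_def by (rule LeastI[of _ i]) (rule i(2))
    moreover have "B (xs ! t) \<le> i" unfolding B_def by (rule Least_le) (rule i(2))
    moreover have "even (xs ! t ! l)" if "l < B (xs ! t)" for l
      using not_less_Least[of l "\<lambda>i. odd (xs ! t ! i)"] that unfolding B_def by blast
    ultimately show "(if t < ?m then B (xs ! t) else 0) < k \<and>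
        odd (xs ! t ! (if t < ?m then B (xs ! t) else 0)) \<and>
        (\<forall>l<(if t < ?m then B (xs ! t) else 0). even (xs ! t ! l))"
      using t i by auto
  qed
qed

theorem theorem4:
  fixes d k :: nat
    and s :: "(real^'n) set \<Rightarrow> (real^'n) set \<times> (real^'n \<Rightarrow> real)"
  assumes "d > 0" and "k > 0" and "odd d"
    and "CARD('n) \<ge> k + ((d + k - 1) choose d)"
    and "bundle_section d k s"
  shows "has_zero k s"
proof -
  note s = \<open>bundle_section d k s\<close>
  define m where "m = (d + k - 1) choose d"
  obtain al blk where al: "bij_betw al {..<m} (multi_indices k d)"
    and mono: "\<And>i j. i \<le> j \<Longrightarrow> j < m \<Longrightarrow> blk i \<le> blk j"
    and blk: "\<And>t. t < m \<Longrightarrow> blk t < k \<and> odd (al t ! blk t) \<and> (\<forall>l<blk t. even (al t ! l))"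
    using enumerate_multi_indices[OF \<open>odd d\<close>, of k] unfolding m_def by metis
  obtain u :: "nat \<Rightarrow> 'n" where u: "bij_betw u {..<CARD('n)} UNIV"
    using ex_bij_betw_nat_finite[of "UNIV :: 'n set"] by (auto simp: atLeast0LessThan)
  \<comment> \<open>The dimension bound provides \<open>m\<close> coordinates for the blocks and
    \<open>k\<close> more for the last coefficients of the frame vectors.\<close>
  have e: "inj_on u {..<m + k}"
    using bij_betw_imp_inj_on[OF u] by (rule inj_on_subset) (use assms(4) m_def in auto)
  have em: "inj_on u {..<m}" using e by (rule inj_on_subset) auto
  have blk_less: "blk c < k" if "c < m" for c using blk that by blast
  let ?b = "block_frame u m blk"
  note frame = block_frame_independent[OF e blk_less]
  define \<Phi> where "\<Phi> t z = form_coeff k d (al t) (frame_form s k (?b z))" for t z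
  have V: "span (?b z ` {..<k}) \<in> k_subspaces k" for z
    by (rule span_image_frame(2)) (use frame in auto)
  have form: "frame_form s k (?b z) \<in> homogeneous_forms k d" for z
    unfolding frame_form_def[abs_def]
    by (rule symmetric_power_coordinates[OF section_in_symmetric_power(1)[OF s V]])
  have al_in: "al t \<in> multi_indices k d" if "t < m" for t
    using al that by (auto simp: bij_betw_def)
  \<comment> \<open>The parity of \<open>\<Phi> t\<close> in block \<open>l\<close> is that of the
    exponent \<open>al t ! l\<close>; since \<open>blk t\<close> is the first odd position, the
    parities are triangular.\<close>
  obtain z where z: "z \<in> unit_cube" "\<And>t. t < m \<Longrightarrow> \<Phi> t z = 0"
  proof (rule cube_borsuk_ulam[of u m blk "\<lambda>t l. odd (al t ! l)" \<Phi>])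
    fix t assume t: "t < m"
    show "continuous_on unit_cube (\<Phi> t)"
      unfolding \<Phi>_def[abs_def] form_coeff_def frame_form_def
      by (intro continuous_intros continuous_on_section_moving[OF s] continuous_on_block_frame)
        (use frame in auto)
  next
    fix t c and z :: "real^'n" assume tc: "t < m" "c < m" "\<bar>z $ u c\<bar> = 1"
    have "frame_form s k (?b (flip u m blk (blk c) z)) =
        (\<lambda>y. frame_form s k (?b z) (y(blk c := - y (blk c))))"
      by (intro ext frame_form_flip[OF e blk_less] tc)
    then have "\<Phi> t (flip u m blk (blk c) z) = (- 1) ^ (al t ! blk c) * \<Phi> t z"
      unfolding \<Phi>_def using form_coeff_reflect[OF form al_in blk_less] tc by simp
    then show "\<Phi> t (flip u m blk (blk c) z) = (if odd (al t ! blk c) then - \<Phi> t z else \<Phi> t z)"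
      by simp
  qed (use em mono blk in auto)
  let ?V = "span (?b z ` {..<k})"
  have "frame_form s k (?b z) y = 0" for y
  proof -
    have "form_coeff k d l (frame_form s k (?b z)) = 0" if "l \<in> multi_indices k d" for l
    proof -
      obtain t where "t < m" "l = al t" using al \<open>l \<in> multi_indices k d\<close> by (auto simp: bij_betw_def)
      then show ?thesis using z(2)[of t] unfolding \<Phi>_def by simp
    qed
    then show ?thesis by (subst homogeneous_form_expansion[OF form]) (simp add: sum.neutral)
  qed
  then have zero: "snd (s ?V) (\<Sum>i<k. y i *\<^sub>R ?b z i) = 0" for y unfolding frame_form_def .
  have "snd (s ?V) v = 0" if "v \<in> ?V" for v
  proof -
    obtain y where "v = (\<Sum>i<k. y i *\<^sub>R ?b z i)" by (rule span_image_eq_sums[OF \<open>v \<in> ?V\<close>])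
    then show ?thesis using zero by simp
  qed
  \<comment> \<open>An element of the symmetric power of \<open>?V\<close> is determined by its
    restriction to \<open>?V\<close>, so vanishing there makes it the zero function.\<close>
  then have "restrict (snd (s ?V)) ?V = restrict (\<lambda>x. 0) ?V" by (intro restrict_ext)
  then have "snd (s ?V) = (\<lambda>x. 0)"
    by (rule inj_onD[OF bij_betw_imp_inj_on[OF bij_betw_symmetric_power[OF subspace_span]]])
      (rule section_in_symmetric_power(1)[OF s V], rule symmetric_power_0)
  then have "s ?V = (?V, \<lambda>x. 0)" using section_in_symmetric_power(2)[OF s V, of z] by simp
  then show ?thesis unfolding has_zero_def using V by blast
qed

end
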